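(* Let $X,Y,Z\subseteq\mathbb{R}^n$ be compact sets which are the supports of Borel probability measures $\mu,\nu,\gamma$ respectively, with $X\cap Y=\emptyset$, and assume $\mu$ and $\gamma$ are absolutely continuous with respect to Lebesgue measure on $\mathbb{R}^n$. Then the problem $$\inf_{\lambda\in\Pi(\mu,\nu,\gamma)}\int\big(|x-y|+|x-z|^2+|y-z|^2\big)\,d\lambda(x,y,z)$$ admits a unique optimal plan, and it is of the form $\lambda=(\mathrm{id}\times T)\#\mu$ for a (unique) measurable map $T:X\to Y\times Z$.
   Context: $|\cdot|$ is the Euclidean norm on $\mathbb{R}^n$. $\Pi(\mu,\nu,\gamma)$ is the set of Borel probability measures on $X\times Y\times Z$ with marginals $\mu,\nu,\gamma$. $(\mathrm{id}\times T)\#\mu$ is the push-forward of $\mu$ under $x\mapsto(x,T(x))$. *)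

theory Defs
  imports "HOL-Probability.Probability"
begin

definition measure_support :: "'a::topological_space measure \<Rightarrow> 'a set" where
  "measure_support M = {x. \<forall>U. open U \<longrightarrow> x \<in> U \<longrightarrow> emeasure M U > 0}"

definition couplings3 ::
  "'a::euclidean_space measure \<Rightarrow> 'a measure \<Rightarrow> 'a measure \<Rightarrow> ('a \<times> 'a \<times> 'a) measure set" where
  "couplings3 \<mu> \<nu> \<gamma> = {L. prob_space L \<and> sets L = sets borel \<and>
      distr L borel fst = \<mu> \<and>
      distr L borel (\<lambda>p. fst (snd p)) = \<nu> \<and>
      distr L borel (\<lambda>p. snd (snd p)) = \<gamma>}"

definition cost3 :: "'a::euclidean_space \<times> 'a \<times> 'a \<Rightarrow> real" where
  "cost3 p = (case p of (x, y, z) \<Rightarrow> norm (x - y) + (norm (x - z))\<^sup>2 + (norm (y - z))\<^sup>2)"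

definition optimal_plan3 ::
  "'a::euclidean_space measure \<Rightarrow> 'a measure \<Rightarrow> 'a measure \<Rightarrow> ('a \<times> 'a \<times> 'a) measure \<Rightarrow> bool" where
  "optimal_plan3 \<mu> \<nu> \<gamma> L \<longleftrightarrow> L \<in> couplings3 \<mu> \<nu> \<gamma> \<and>
      (\<forall>L'\<in>couplings3 \<mu> \<nu> \<gamma>. integral\<^sup>L L cost3 \<le> integral\<^sup>L L' cost3)"

end

theory Submission
  imports Defs
begin

text \<open>
  Let \<open>\<Gamma>\<close> be the support of an optimal plan. Exchanging the \<open>x\<close>-coordinates, or the \<open>z\<close>-coordinates, of
  two points of \<open>\<Gamma>\<close> cannot lower the cost. For \<open>z\<close> this says that the relation \<open>z \<mapsto> x + y\<close> is monotone
  on \<open>\<Gamma>\<close>. For \<open>x\<close>, semiconcavity of the cost away from \<open>x = y\<close> makes \<open>x \<mapsto> M x - G\<close> monotone, where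
  \<open>G = (x - y)/|x - y| + 2 (x - z)\<close> is the gradient of the cost in \<open>x\<close>. A monotone relation is
  single-valued Lebesgue-almost everywhere, since it can be multivalued only countably often on each
  line parallel to an axis. So for almost every \<open>x\<close> any two points \<open>(x, y, z)\<close>, \<open>(x, y', z')\<close> of \<open>\<Gamma>\<close>
  have the same \<open>G\<close>, that is \<open>e - e' = 2 (z - z')\<close> for the unit vectors \<open>e\<close>, \<open>e'\<close> along \<open>x - y\<close>,
  \<open>x - y'\<close>. The \<open>z\<close>-exchange gives \<open>(e - e') \<bullet> (y - y') \<ge> 0\<close>, and monotonicity of the gradient of the
  norm forces \<open>e = e'\<close>; thus \<open>z = z'\<close>, and then \<open>y = y'\<close> because \<open>x + y\<close> is a function of \<open>z\<close>.

  Hence every optimal plan is concentrated on a graph over \<open>x\<close>; applied to the average of two optimal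
  plans, this gives uniqueness. Existence is weak compactness: a compact set is the image of a set of
  reals under a continuous map with a Borel right inverse, which reduces Prokhorov's theorem
  to Helly's.
\<close>

subsection \<open>Supports of measures\<close>

lemma closed_measure_support: "closed (measure_support M)"
proof -
  have "- measure_support M = \<Union>{U. open U \<and> emeasure M U = 0}"
    by (auto simp: measure_support_def zero_less_iff_neq_zero)
  moreover have "open (\<Union>{U. open U \<and> emeasure M U = 0})"
    by (intro open_Union) auto
  ultimately show ?thesis
    by (simp add: closed_def)
qed

text \<open>The complement of the support is a union of open null sets, and the Lindelof property
  makes countably many of them suffice.\<close>

lemma AE_in_measure_support:
  fixes M :: "'a::second_countable_topology measure"
  assumes M: "sets M = sets borel"
  shows "AE x in M. x \<in> measure_support M"
proof -
  let ?F = "{U. open U \<and> emeasure M U = 0}"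
  obtain F where F: "F \<subseteq> ?F" "countable F" "\<Union>F = \<Union>?F"
    by (rule Lindelof[of ?F]) auto
  have "(\<Union>U\<in>F. U) \<in> null_sets M"
    using F by (intro null_sets_UN') (auto simp: null_sets_def M)
  moreover have "- measure_support M = \<Union>?F"
    by (auto simp: measure_support_def zero_less_iff_neq_zero)
  ultimately have "- measure_support M \<in> null_sets M"
    using F(3) by simp
  from AE_not_in[OF this] show ?thesis
    by simp
qed

text \<open>Preimages of neighbourhoods of \<open>f p\<close> are neighbourhoods of
  \<open>p\<close>, hence of positive mass. For the coordinate maps this places the support of a
  coupling in the product of the marginal supports.\<close>

lemma measure_support_distr_subset:
  fixes L :: "'b::topological_space measure" and f :: "'b \<Rightarrow> 'a::topological_space"
  assumes f: "continuous_on UNIV f" and L: "sets L = sets borel"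
    and p: "p \<in> measure_support L"
  shows "f p \<in> measure_support (distr L borel f)"
  unfolding measure_support_def
proof (intro CollectI allI impI)
  fix U assume U: "open U" "f p \<in> U"
  have [measurable]: "f \<in> L \<rightarrow>\<^sub>M borel"
    using borel_measurable_continuous_onI[OF f] L by (simp cong: measurable_cong_sets)
  have "open (f -` U)"
    using f U(1) by (simp add: continuous_on_open_vimage)
  then have "emeasure L (f -` U) > 0"
    using p U(2) by (auto simp: measure_support_def)
  moreover have "space L = UNIV"
    using sets_eq_imp_space_eq[OF L] by simp
  ultimately show "emeasure (distr L borel f) U > 0"
    using U(1) by (subst emeasure_distr) auto
qed

subsection \<open>Monotone relations are almost everywhere single-valued\<close>

text \<open>Pairs are read as (point, value): this is monotonicity of a multivalued operator, as for
  subdifferentials of convex functions.\<close>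

definition monotone_rel :: "('a::real_inner \<times> 'a) set \<Rightarrow> bool" where
  "monotone_rel S \<longleftrightarrow> (\<forall>(x, p)\<in>S. \<forall>(y, q)\<in>S. 0 \<le> (x - y) \<bullet> (p - q))"

text \<open>The intervals from \<open>l t\<close> to \<open>r t\<close> are nondegenerate and
  ordered like their indices, so a rational chosen in each one gives an injection into the
  rationals.\<close>

lemma countable_nondegenerate_gaps:
  fixes l r :: "real \<Rightarrow> real"
  assumes lr: "\<And>t. t \<in> A \<Longrightarrow> l t < r t"
    and sep: "\<And>s t. s \<in> A \<Longrightarrow> t \<in> A \<Longrightarrow> s < t \<Longrightarrow> r s \<le> l t"
  shows "countable A"
proof -
  have "\<forall>t\<in>A. \<exists>q::rat. l t < of_rat q \<and> of_rat q < r t"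
    using lr of_rat_dense by blast
  then obtain q :: "real \<Rightarrow> rat" where q: "\<And>t. t \<in> A \<Longrightarrow> l t < of_rat (q t) \<and> of_rat (q t) < r t"
    by metis
  have "inj_on q A"
  proof (rule linorder_inj_onI')
    fix s t assume "s \<in> A" "t \<in> A" "s < t"
    with q[of s] q[of t] sep[of s t] have "(of_rat (q s) :: real) < of_rat (q t)"
      by linarith
    then show "q s \<noteq> q t" by auto
  qed
  then show ?thesis
    by (rule countableI')
qed

lemma null_set_if_countable_on_lines:
  fixes N :: "'a::euclidean_space set" and b :: 'a
  assumes N[measurable]: "N \<in> sets borel"
    and cnt: "\<And>z. countable {t. z + t *\<^sub>R b \<in> N}"
  shows "N \<in> null_sets lborel"
proof -
  \<comment> \<open>By translation invariance, averaging \<open>N - t b\<close> over \<open>t \<in> [0, 1]\<close> does not change the measure;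
    by Tonelli the average is an integral of measures of countable sets.\<close>
  let ?f = "\<lambda>(z, t). indicator N (z + t *\<^sub>R b) * indicator {0..1} t :: ennreal"
  have meas[measurable]: "?f \<in> borel_measurable (lborel \<Otimes>\<^sub>M lborel)"
    by measurable
  have "emeasure lborel N = (\<integral>\<^sup>+t. emeasure lborel N * indicator {0..1::real} t \<partial>lborel)"
    by (simp add: nn_integral_cmult)
  also have "\<dots> = (\<integral>\<^sup>+t. (\<integral>\<^sup>+z. ?f (z, t) \<partial>lborel) \<partial>lborel)"
  proof (rule nn_integral_cong)
    fix t :: real
    have "emeasure lborel N = (\<integral>\<^sup>+z. indicator N z \<partial>distr lborel borel ((+) (t *\<^sub>R b)))"
      by (simp add: lborel_distr_plus)
    also have "\<dots> = (\<integral>\<^sup>+z. indicator N (z + t *\<^sub>R b) \<partial>lborel)"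
      by (subst nn_integral_distr) (auto simp: add.commute)
    finally have "emeasure lborel N = (\<integral>\<^sup>+z. indicator N (z + t *\<^sub>R b) \<partial>lborel)" .
    then show "emeasure lborel N * indicator {0..1::real} t = (\<integral>\<^sup>+z. ?f (z, t) \<partial>lborel)"
      by (simp add: nn_integral_multc)
  qed
  also have "\<dots> = (\<integral>\<^sup>+z. (\<integral>\<^sup>+t. ?f (z, t) \<partial>lborel) \<partial>lborel)"
    by (rule lborel_pair.Fubini[OF meas])
  also have "\<dots> = integral\<^sup>N lborel (\<lambda>z::'a. 0)"
  proof (rule nn_integral_cong)
    fix z :: 'a
    have "AE t in lborel. t \<notin> {t. z + t *\<^sub>R b \<in> N}"
      by (intro AE_not_in countable_imp_null_set_lborel cnt)
    then have "AE t in lborel. ?f (z, t) = 0"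
      by eventually_elim simp
    then show "(\<integral>\<^sup>+t. ?f (z, t) \<partial>lborel) = 0"
      by (subst nn_integral_0_iff_AE) auto
  qed
  also have "\<dots> = 0" by simp
  finally show ?thesis
    by (intro null_setsI) auto
qed

text \<open>Along a line in direction \<open>b\<close>, the \<open>b\<close>-components of the
  values form a monotone relation on the reals, whose jumps are non-overlapping intervals.
  Compactness of \<open>S\<close> makes the exceptional sets Borel.\<close>

lemma monotone_rel_single_valued_AE:
  fixes S :: "('a::euclidean_space \<times> 'a) set"
  assumes mono: "monotone_rel S" and cpt: "compact S"
  shows "{z. \<exists>p q. (z, p) \<in> S \<and> (z, q) \<in> S \<and> p \<noteq> q} \<in> null_sets lborel"
proof -
  define N where "N b = {z. \<exists>p q. (z, p) \<in> S \<and> (z, q) \<in> S \<and> p \<bullet> b < q \<bullet> b}" for b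
  have "N b \<in> null_sets lborel" if b: "b \<in> Basis" for b
  proof (rule null_set_if_countable_on_lines)
    \<comment> \<open>A gap of at least \<open>1 / Suc k\<close> is a closed condition, unlike a
      strict inequality; \<open>N b\<close> thus becomes a countable union of projections of compact
      sets.\<close>
    define C where "C k = (S \<times> S) \<inter> {w. fst (fst w) = fst (snd w) \<and>
        snd (fst w) \<bullet> b + 1 / Suc k \<le> snd (snd w) \<bullet> b}" for k
    have "compact (C k)" for k
      unfolding C_def
      by (intro compact_Int_closed compact_Times cpt closed_Collect_conj closed_Collect_eq closed_Collect_le
          continuous_intros)
    then have "compact ((\<lambda>w. fst (fst w)) ` C k)" for k
      by (intro compact_continuous_image continuous_intros)
    moreover have "N b = (\<Union>k. (\<lambda>w. fst (fst w)) ` C k)"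
    proof safe
      fix z assume "z \<in> N b"
      then obtain p q where pq: "(z, p) \<in> S" "(z, q) \<in> S" "p \<bullet> b < q \<bullet> b"
        by (auto simp: N_def)
      then obtain k where "1 / Suc k < q \<bullet> b - p \<bullet> b"
        using nat_approx_posE[of "q \<bullet> b - p \<bullet> b"] by auto
      with pq have "((z, p), (z, q)) \<in> C k"
        by (auto simp: C_def)
      then show "z \<in> (\<Union>k. (\<lambda>w. fst (fst w)) ` C k)"
        by force
    next
      fix k z p z' q assume "((z, p), z', q) \<in> C k"
      then have *: "(z, p) \<in> S" "(z, q) \<in> S" "p \<bullet> b + 1 / Suc k \<le> q \<bullet> b"
        by (auto simp: C_def)
      have "0 < 1 / real (Suc k)" by simp
      with *(3) have "p \<bullet> b < q \<bullet> b" by linarith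
      with * show "fst (fst ((z, p), z', q)) \<in> N b"
        by (auto simp: N_def)
    qed
    ultimately show "N b \<in> sets borel"
      by (simp add: borel_compact sets.countable_UN image_subset_iff)
  next
    fix z
    let ?A = "{t. z + t *\<^sub>R b \<in> N b}"
    have "\<forall>t\<in>?A. \<exists>p q. (z + t *\<^sub>R b, p) \<in> S \<and> (z + t *\<^sub>R b, q) \<in> S \<and> p \<bullet> b < q \<bullet> b"
      by (auto simp: N_def)
    then obtain p q where pq: "\<And>t. t \<in> ?A \<Longrightarrow>
        (z + t *\<^sub>R b, p t) \<in> S \<and> (z + t *\<^sub>R b, q t) \<in> S \<and> p t \<bullet> b < q t \<bullet> b"
      by metis
    show "countable ?A"
    proof (rule countable_nondegenerate_gaps[where l = "\<lambda>t. p t \<bullet> b" and r = "\<lambda>t. q t \<bullet> b"])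
      fix s t assume st: "s \<in> ?A" "t \<in> ?A" "s < t"
      have "0 \<le> ((z + s *\<^sub>R b) - (z + t *\<^sub>R b)) \<bullet> (q s - p t)"
        using mono pq[OF st(1)] pq[OF st(2)] unfolding monotone_rel_def by blast
      also have "\<dots> = (s - t) * (q s \<bullet> b - p t \<bullet> b)"
        by (simp add: algebra_simps inner_commute)
      finally show "q s \<bullet> b \<le> p t \<bullet> b"
        using st(3) by (simp add: zero_le_mult_iff)
    qed (use pq in auto)
  qed
  then have "(\<Union>b\<in>Basis. N b) \<in> null_sets lborel"
    by (intro null_sets_UN' countable_finite) auto
  moreover have "{z. \<exists>p q. (z, p) \<in> S \<and> (z, q) \<in> S \<and> p \<noteq> q} = (\<Union>b\<in>Basis. N b)"
  proof safe
    fix z p q assume *: "(z, p) \<in> S" "(z, q) \<in> S" "p \<noteq> q"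
    then obtain b where "b \<in> Basis" "p \<bullet> b \<noteq> q \<bullet> b"
      using euclidean_eqI by blast
    then show "z \<in> (\<Union>b\<in>Basis. N b)"
      using * by (auto simp: N_def neq_iff)
  qed (auto simp: N_def)
  ultimately show ?thesis by simp
qed

subsection \<open>Couplings\<close>

lemma continuous_on_cost3: "continuous_on S cost3"
  unfolding cost3_def case_prod_unfold by (intro continuous_intros)

lemma borel_measurable_cost3[measurable]: "cost3 \<in> borel_measurable borel"
  by (intro borel_measurable_continuous_onI continuous_on_cost3)

lemma couplings3D:
  assumes "L \<in> couplings3 \<mu> \<nu> \<gamma>"
  shows "prob_space L" "sets L = sets borel" "space L = UNIV" "distr L borel fst = \<mu>"
    "distr L borel (\<lambda>p. fst (snd p)) = \<nu>" "distr L borel (\<lambda>p. snd (snd p)) = \<gamma>"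
proof -
  show *: "prob_space L" "sets L = sets borel" "distr L borel fst = \<mu>"
    "distr L borel (\<lambda>p. fst (snd p)) = \<nu>" "distr L borel (\<lambda>p. snd (snd p)) = \<gamma>"
    using assms by (auto simp: couplings3_def)
  show "space L = UNIV"
    using sets_eq_imp_space_eq[OF *(2)] by simp
qed

lemma couplings3_AE_marginal:
  assumes L: "L \<in> couplings3 \<mu> \<nu> \<gamma>"
  shows "AE x in \<mu>. P x \<Longrightarrow> AE p in L. P (fst p)"
    and "AE y in \<nu>. P y \<Longrightarrow> AE p in L. P (fst (snd p))"
    and "AE z in \<gamma>. P z \<Longrightarrow> AE p in L. P (snd (snd p))"
proof -
  note [measurable_cong] = couplings3D(2)[OF L]
  have [measurable]: "fst \<in> L \<rightarrow>\<^sub>M borel" "(\<lambda>p. fst (snd p)) \<in> L \<rightarrow>\<^sub>M borel"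
    "(\<lambda>p. snd (snd p)) \<in> L \<rightarrow>\<^sub>M borel"
    by (auto simp: measurable_cong_sets[OF couplings3D(2)[OF L] refl] 
        intro!: borel_measurable_continuous_onI continuous_intros)
  show "AE x in \<mu>. P x \<Longrightarrow> AE p in L. P (fst p)"
    unfolding couplings3D(4)[OF L, symmetric] by (rule AE_distrD) measurable
  show "AE y in \<nu>. P y \<Longrightarrow> AE p in L. P (fst (snd p))"
    unfolding couplings3D(5)[OF L, symmetric] by (rule AE_distrD) measurable
  show "AE z in \<gamma>. P z \<Longrightarrow> AE p in L. P (snd (snd p))"
    unfolding couplings3D(6)[OF L, symmetric] by (rule AE_distrD) measurable
qed

lemma couplings3_AE_supports:
  assumes L: "L \<in> couplings3 \<mu> \<nu> \<gamma>"
  shows "AE p in L. p \<in> measure_support \<mu> \<times> measure_support \<nu> \<times> measure_support \<gamma>"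
proof -
  have "sets \<mu> = sets borel" "sets \<nu> = sets borel" "sets \<gamma> = sets borel"
    using couplings3D(4-6)[OF L] by auto
  note AE_in_measure_support[OF this(1)] AE_in_measure_support[OF this(2)] AE_in_measure_support[OF this(3)]
  note couplings3_AE_marginal(1)[OF L this(1)] couplings3_AE_marginal(2)[OF L this(2)]
    couplings3_AE_marginal(3)[OF L this(3)]
  then show ?thesis
    by eventually_elim (auto simp: mem_Times_iff)
qed

lemma couplings3_support_subset:
  assumes L: "L \<in> couplings3 \<mu> \<nu> \<gamma>"
  shows "measure_support L \<subseteq> measure_support \<mu> \<times> measure_support \<nu> \<times> measure_support \<gamma>"
proof
  fix p assume p: "p \<in> measure_support L"
  note supp = measure_support_distr_subset[OF _ couplings3D(2)[OF L] p]
  have "fst p \<in> measure_support (distr L borel fst)"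
    "fst (snd p) \<in> measure_support (distr L borel (\<lambda>p. fst (snd p)))"
    "snd (snd p) \<in> measure_support (distr L borel (\<lambda>p. snd (snd p)))"
    by (intro supp continuous_intros)+
  then show "p \<in> measure_support \<mu> \<times> measure_support \<nu> \<times> measure_support \<gamma>"
    by (simp add: couplings3D(4-6)[OF L] mem_Times_iff)
qed

text \<open>The cost is bounded on the compact product of supports, which carries \<open>L\<close>.
  Integrability matters because the Bochner integral of a non-integrable function is 0 by
  convention.\<close>

lemma couplings3_integrable_cost:
  assumes L: "L \<in> couplings3 \<mu> \<nu> \<gamma>"
    and cpt: "compact (measure_support \<mu>)" "compact (measure_support \<nu>)" "compact (measure_support \<gamma>)"
  shows "integrable L cost3"
proof -
  interpret prob_space L using couplings3D(1)[OF L] .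
  let ?K = "measure_support \<mu> \<times> measure_support \<nu> \<times> measure_support \<gamma>"
  have "compact (cost3 ` ?K)"
    by (intro compact_continuous_image continuous_on_cost3 compact_Times cpt)
  then obtain B where B: "\<And>p. p \<in> ?K \<Longrightarrow> norm (cost3 p) \<le> B"
    by (meson compact_imp_bounded bounded_iff imageI)
  have "AE p in L. norm (cost3 p) \<le> B"
    using couplings3_AE_supports[OF L] by eventually_elim (rule B)
  moreover have "cost3 \<in> borel_measurable L"
    using couplings3D(2)[OF L] by (simp add: measurable_cong_sets[OF couplings3D(2)[OF L] refl])
  ultimately show ?thesis
    by (rule integrable_const_bound)
qed

subsection \<open>Exchange inequalities for optimal plans\<close>

text \<open>The swap of the two factors preserves the product measure and, by symmetry, the set
  \<open>W\<close>. On \<open>W\<close> the second coordinate therefore contributes to the law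
  exactly what the first would.\<close>

lemma (in prob_space) partial_exchange_distr:
  fixes \<pi> :: "'a \<Rightarrow> 'b" and W :: "('a \<times> 'a) set"
  assumes W[measurable]: "W \<in> sets (M \<Otimes>\<^sub>M M)"
    and sym: "\<And>p q. (p, q) \<in> W \<longleftrightarrow> (q, p) \<in> W"
    and \<pi>[measurable]: "\<pi> \<in> M \<rightarrow>\<^sub>M N"
  shows "distr (M \<Otimes>\<^sub>M M) N (\<lambda>w. if w \<in> W then \<pi> (snd w) else \<pi> (fst w)) = distr M N \<pi>"
    (is "distr ?P N ?g = _")
proof (rule measure_eqI)
  interpret P: pair_sigma_finite M M ..
  fix A assume "A \<in> sets (distr ?P N ?g)"
  then have A[measurable]: "A \<in> sets N" by simp
  let ?F = "{w \<in> space ?P. \<pi> (fst w) \<in> A}" and ?S = "{w \<in> space ?P. \<pi> (snd w) \<in> A}"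
  have [measurable]: "?g \<in> ?P \<rightarrow>\<^sub>M N" by measurable
  have "emeasure (distr ?P N ?g) A = emeasure ?P (W \<inter> ?S \<union> (space ?P - W) \<inter> ?F)"
    using sets.sets_into_space[OF W]
    by (subst emeasure_distr) (auto intro!: arg_cong[where f = "emeasure ?P"] split: if_splits)
  also have "\<dots> = emeasure ?P (W \<inter> ?S) + emeasure ?P ((space ?P - W) \<inter> ?F)"
    by (rule plus_emeasure[symmetric]) auto
  also have "emeasure ?P (W \<inter> ?S) = emeasure (distr ?P ?P (\<lambda>(x, y). (y, x))) (W \<inter> ?S)"
    by (subst P.distr_pair_swap) simp
  also have "\<dots> = emeasure ?P (W \<inter> ?F)"
    using sets.sets_into_space[OF W] sym
    by (subst emeasure_distr) (auto intro!: arg_cong[where f = "emeasure ?P"] simp: space_pair_measure)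
  also have "emeasure ?P (W \<inter> ?F) + emeasure ?P ((space ?P - W) \<inter> ?F) = emeasure ?P ?F"
    using sets.sets_into_space[OF W]
    by (subst plus_emeasure) (auto intro!: arg_cong[where f = "emeasure ?P"])
  also have "\<dots> = emeasure (distr ?P M fst) (\<pi> -` A \<inter> space M)"
    by (subst emeasure_distr) (auto intro!: arg_cong[where f = "emeasure ?P"] simp: space_pair_measure)
  also have "\<dots> = emeasure (distr M N \<pi>) A"
    by (simp add: distr_pair_fst emeasure_distr)
  finally show "emeasure (distr ?P N ?g) A = emeasure (distr M N \<pi>) A" .
qed simp

lemma sets_pair_measure_borel:
  fixes L :: "'a::second_countable_topology measure" and M :: "'b::second_countable_topology measure"
  assumes "sets L = sets borel" "sets M = sets borel"
  shows "sets (L \<Otimes>\<^sub>M M) = sets borel"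
  using sets_pair_measure_cong[OF assms] unfolding borel_prod .

text \<open>Two-point cyclical monotonicity on the support. Each \<open>proj\<close> hypothesis says
  that a coordinate of \<open>\<sigma> p q\<close> comes always from \<open>p\<close> or always from
  \<open>q\<close>. A strictly profitable exchange at two support points would stay profitable on a
  neighbourhood of positive mass, contradicting optimality.\<close>

lemma optimal_plan3_exchange:
  fixes \<sigma> :: "'a::euclidean_space \<times> 'a \<times> 'a \<Rightarrow> 'a \<times> 'a \<times> 'a \<Rightarrow> 'a \<times> 'a \<times> 'a"
  assumes opt: "optimal_plan3 \<mu> \<nu> \<gamma> L"
    and cpt: "compact (measure_support \<mu>)" "compact (measure_support \<nu>)" "compact (measure_support \<gamma>)"
    and cont: "continuous_on UNIV (\<lambda>w. \<sigma> (fst w) (snd w))"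
    and proj1: "(\<forall>p q. fst (\<sigma> p q) = fst p) \<or> (\<forall>p q. fst (\<sigma> p q) = fst q)"
    and proj2: "(\<forall>p q. fst (snd (\<sigma> p q)) = fst (snd p)) \<or> (\<forall>p q. fst (snd (\<sigma> p q)) = fst (snd q))"
    and proj3: "(\<forall>p q. snd (snd (\<sigma> p q)) = snd (snd p)) \<or> (\<forall>p q. snd (snd (\<sigma> p q)) = snd (snd q))"
    and pq: "p0 \<in> measure_support L" "q0 \<in> measure_support L"
  shows "cost3 p0 + cost3 q0 \<le> cost3 (\<sigma> p0 q0) + cost3 (\<sigma> q0 p0)"
proof -
  have L: "L \<in> couplings3 \<mu> \<nu> \<gamma>"
    using opt by (auto simp: optimal_plan3_def)
  interpret prob_space L using couplings3D(1)[OF L] .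
  interpret P: pair_prob_space L L ..
  let ?P = "L \<Otimes>\<^sub>M L"
  note sL = couplings3D(2)[OF L]
  note sP = sets_pair_measure_borel[OF sL sL]
  define gap where "gap w = cost3 (fst w) + cost3 (snd w)
    - cost3 (\<sigma> (fst w) (snd w)) - cost3 (\<sigma> (snd w) (fst w))" for w
  define W where "W = {w. gap w > 0}"
  have cont': "continuous_on UNIV (\<lambda>w. \<sigma> (snd w) (fst w))"
    using continuous_on_compose2[OF cont continuous_on_swap[of UNIV]] by simp
  have cont_gap: "continuous_on UNIV gap"
    unfolding gap_def
    by (intro continuous_intros continuous_on_compose2[OF continuous_on_cost3[of UNIV]] cont cont') auto
  have W_open: "open W"
    unfolding W_def by (intro open_Collect_less cont_gap continuous_intros)
  have W_meas: "W \<in> sets ?P"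
    using W_open by (simp add: sP)
  have W_sym: "(p, q) \<in> W \<longleftrightarrow> (q, p) \<in> W" for p q
    by (simp add: W_def gap_def algebra_simps)
  \<comment> \<open>Draw \<open>(p, q)\<close> from \<open>L \<Otimes> L\<close> and exchange coordinates exactly when this is profitable. As the
    profitable set is symmetric, the law of the outcome has the same marginals as \<open>L\<close>.\<close>
  define \<Phi> where "\<Phi> w = (if w \<in> W then \<sigma> (fst w) (snd w) else fst w)" for w
  have "\<Phi> \<in> borel \<rightarrow>\<^sub>M borel"
    unfolding \<Phi>_def
    by (intro measurable_If_set borel_measurable_continuous_onI cont continuous_intros)
      (use W_open in auto)
  then have \<Phi>[measurable]: "\<Phi> \<in> ?P \<rightarrow>\<^sub>M borel"
    by (simp add: measurable_cong_sets[OF sP refl])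
  have marg: "distr (distr ?P borel \<Phi>) borel \<pi> = distr L borel \<pi>"
    if \<pi>: "\<pi> \<in> borel_measurable borel"
      and "(\<forall>p q. \<pi> (\<sigma> p q) = \<pi> p) \<or> (\<forall>p q. \<pi> (\<sigma> p q) = \<pi> q)" for \<pi> :: "'a \<times> 'a \<times> 'a \<Rightarrow> 'a"
    using that(2)
  proof
    have [measurable]: "\<pi> \<in> L \<rightarrow>\<^sub>M borel"
      using \<pi> by (simp add: measurable_cong_sets[OF sL refl])
    have eq: "distr (distr ?P borel \<Phi>) borel \<pi> = distr ?P borel (\<pi> \<circ> \<Phi>)"
      by (rule distr_distr[OF \<pi> \<Phi>])
    { assume "\<forall>p q. \<pi> (\<sigma> p q) = \<pi> p"
      then have "\<pi> \<circ> \<Phi> = \<pi> \<circ> fst"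
        by (auto simp: \<Phi>_def)
      then have "distr (distr ?P borel \<Phi>) borel \<pi> = distr (distr ?P L fst) borel \<pi>"
        by (subst distr_distr) (auto simp: eq)
      then show "distr (distr ?P borel \<Phi>) borel \<pi> = distr L borel \<pi>"
        by (simp add: distr_pair_fst) }
    { assume "\<forall>p q. \<pi> (\<sigma> p q) = \<pi> q"
      then have "\<pi> \<circ> \<Phi> = (\<lambda>w. if w \<in> W then \<pi> (snd w) else \<pi> (fst w))"
        by (auto simp: \<Phi>_def)
      then show "distr (distr ?P borel \<Phi>) borel \<pi> = distr L borel \<pi>"
        using partial_exchange_distr[OF W_meas W_sym, of \<pi> borel] by (simp add: eq) }
  qed
  have L': "distr ?P borel \<Phi> \<in> couplings3 \<mu> \<nu> \<gamma>"
    unfolding couplings3_def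
  proof (intro CollectI conjI)
    show "prob_space (distr ?P borel \<Phi>)"
      by (rule P.prob_space_distr) measurable
    show "distr (distr ?P borel \<Phi>) borel fst = \<mu>"
      unfolding couplings3D(4)[OF L, symmetric]
      by (intro marg proj1 borel_measurable_continuous_onI continuous_intros)
    show "distr (distr ?P borel \<Phi>) borel (\<lambda>p. fst (snd p)) = \<nu>"
      unfolding couplings3D(5)[OF L, symmetric]
      by (intro marg proj2 borel_measurable_continuous_onI continuous_intros)
    show "distr (distr ?P borel \<Phi>) borel (\<lambda>p. snd (snd p)) = \<gamma>"
      unfolding couplings3D(6)[OF L, symmetric]
      by (intro marg proj3 borel_measurable_continuous_onI continuous_intros)
  qed simp
  have [measurable]: "cost3 \<in> borel_measurable L"
    by (simp add: measurable_cong_sets[OF sL refl])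
  have int_\<Phi>: "integrable ?P (\<lambda>w. cost3 (\<Phi> w))"
    using couplings3_integrable_cost[OF L' cpt] by (simp add: integrable_distr_eq)
  have int_\<Phi>': "integrable ?P (\<lambda>w. cost3 (\<Phi> (snd w, fst w)))"
    using P.integrable_product_swap[OF int_\<Phi>] by (simp add: case_prod_unfold)
  have int_c: "integrable L cost3"
    by (rule couplings3_integrable_cost[OF L cpt])
  have int_fst: "integrable ?P (\<lambda>w. cost3 (fst w))" and eq_fst: "(\<integral>w. cost3 (fst w) \<partial>?P) = integral\<^sup>L L cost3"
    using int_c by (subst (asm) distr_pair_fst[of L, symmetric], simp add: integrable_distr_eq)
      (subst (2) distr_pair_fst[of L, symmetric], simp add: integral_distr)
  have int_snd: "integrable ?P (\<lambda>w. cost3 (snd w))" and eq_snd: "(\<integral>w. cost3 (snd w) \<partial>?P) = integral\<^sup>L L cost3"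
    using P.integrable_product_swap[OF int_fst] P.integral_product_swap[of "\<lambda>w. cost3 (fst w)"] eq_fst
    by (simp_all add: case_prod_unfold)
  \<comment> \<open>\<open>\<Phi>\<close> keeps only one of the two exchanged points; adding its
    value at the swapped pair restores the other. So \<open>?h\<close> is \<open>gap\<close> on
    \<open>W\<close> and 0 elsewhere, while its integral is twice the cost saved, which optimality
    bounds by 0.\<close>
  let ?h = "\<lambda>w. cost3 (fst w) + cost3 (snd w) - cost3 (\<Phi> w) - cost3 (\<Phi> (snd w, fst w))"
  have h_eq: "?h w = (if w \<in> W then gap w else 0)" for w
    using W_sym[of "fst w" "snd w"] by (auto simp: \<Phi>_def gap_def)
  have int_h: "integrable ?P ?h"
    by (intro Bochner_Integration.integrable_diff Bochner_Integration.integrable_add int_fst int_snd int_\<Phi> int_\<Phi>')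
  have "(\<integral>w. ?h w \<partial>?P) = 2 * integral\<^sup>L L cost3 - 2 * integral\<^sup>L (distr ?P borel \<Phi>) cost3"
    using P.integral_product_swap[of "\<lambda>w. cost3 (\<Phi> w)"]
    by (simp add: int_fst int_snd int_\<Phi> int_\<Phi>' eq_fst eq_snd integral_distr case_prod_unfold)
  also have "\<dots> \<le> 0"
    using opt L' by (auto simp: optimal_plan3_def)
  finally have "(\<integral>w. ?h w \<partial>?P) \<le> 0" .
  moreover have "AE w in ?P. 0 \<le> ?h w"
    unfolding h_eq by (auto simp: W_def)
  moreover have "0 \<le> (\<integral>w. ?h w \<partial>?P)"
    using calculation(2) by (rule integral_nonneg_AE)
  ultimately have "AE w in ?P. ?h w = 0"
    using integral_nonneg_eq_0_iff_AE[OF int_h] by linarith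
  then have "AE w in ?P. w \<notin> W"
    unfolding h_eq by eventually_elim (auto simp: W_def split: if_splits)
  then have W_null: "emeasure ?P W = 0"
    using AE_iff_measurable[OF W_meas, of "\<lambda>w. w \<notin> W"] sets.sets_into_space[OF W_meas] by auto
  have "(p0, q0) \<notin> W"
  proof
    assume "(p0, q0) \<in> W"
    then obtain A B where AB: "open A" "open B" "(p0, q0) \<in> A \<times> B" "A \<times> B \<subseteq> W"
      using W_open by (auto simp: open_prod_def)
    have "emeasure L A > 0" "emeasure L B > 0"
      using pq AB by (auto simp: measure_support_def)
    moreover have "emeasure ?P (A \<times> B) = emeasure L A * emeasure L B"
      using AB by (intro emeasure_pair_measure_Times) (auto simp: sL)
    moreover have "emeasure ?P (A \<times> B) \<le> emeasure ?P W"
      using AB(4) W_meas by (rule emeasure_mono)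
    ultimately show False
      using W_null by auto
  qed
  then show ?thesis
    by (simp add: W_def gap_def)
qed

section \<open>Semiconcavity of the cost and exchanges of single coordinates\<close>

text \<open>Expand \<open>(norm (a + h))\<^sup>2\<close> in the inequality \<open>2 * norm a * norm
  (a + h) \<le> (norm a)\<^sup>2 + (norm (a + h))\<^sup>2\<close> and divide by
  \<open>2 * norm a\<close>. The vector \<open>sgn a\<close> is the gradient of the norm at
  \<open>a\<close>.\<close>

lemma norm_add_le_quadratic:
  fixes a h :: "'a::real_inner"
  assumes "0 < \<delta>" "\<delta> \<le> norm a"
  shows "norm (a + h) \<le> norm a + sgn a \<bullet> h + (norm h)\<^sup>2 / (2 * \<delta>)"
proof -
  have pos: "0 < norm a" using assms by linarith
  have "0 \<le> (norm (a + h) - norm a)\<^sup>2" by simp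
  then have "2 * norm a * norm (a + h) \<le> (norm a)\<^sup>2 + (norm (a + h))\<^sup>2"
    by (simp add: power2_diff mult.commute mult.left_commute)
  also have "(norm (a + h))\<^sup>2 = (norm a)\<^sup>2 + 2 * (a \<bullet> h) + (norm h)\<^sup>2"
    by (simp add: power2_norm_eq_inner algebra_simps inner_commute)
  finally have "norm (a + h) \<le> norm a + sgn a \<bullet> h + (norm h)\<^sup>2 / (2 * norm a)"
    using pos by (simp add: sgn_div_norm field_simps power2_eq_square)
  also have "(norm h)\<^sup>2 / (2 * norm a) \<le> (norm h)\<^sup>2 / (2 * \<delta>)"
    using assms by (intro divide_left_mono mult_pos_pos) auto
  finally show ?thesis by simp
qed

text \<open>The norm contributes \<open>1 / (2 * \<delta>)\<close> to the quadratic coefficient and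
  the squared distance to \<open>z\<close> contributes exactly 1; the term in \<open>y\<close> and
  \<open>z\<close> is constant.\<close>

lemma cost3_semiconcave:
  assumes "0 < \<delta>" "\<delta> \<le> norm (x - y)"
  shows "cost3 (x', y, z) \<le> cost3 (x, y, z) + (sgn (x - y) + 2 *\<^sub>R (x - z)) \<bullet> (x' - x)
    + (1 / (2 * \<delta>) + 1) * (norm (x' - x))\<^sup>2"
proof -
  have "norm (x' - y) \<le> norm (x - y) + sgn (x - y) \<bullet> (x' - x) + (norm (x' - x))\<^sup>2 / (2 * \<delta>)"
    using norm_add_le_quadratic[OF assms, of "x' - x"] by simp
  moreover have "(norm (x' - z))\<^sup>2 = (norm (x - z))\<^sup>2 + 2 * ((x - z) \<bullet> (x' - x)) + (norm (x' - x))\<^sup>2"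
    by (simp add: power2_norm_eq_inner algebra_simps inner_commute)
  ultimately show ?thesis
    by (simp add: cost3_def inner_add_left algebra_simps add_divide_distrib)
qed

text \<open>For the unit vectors \<open>e\<close>, \<open>f\<close> along \<open>a\<close>,
  \<open>b\<close>, the inner product in \<open>le\<close> equals
  \<open>(norm a + norm b) * (1 - e \<bullet> f)\<close>. Its sign forces
  \<open>e \<bullet> f \<ge> 1\<close>, so \<open>e - f\<close> has norm 0.\<close>

lemma sgn_eq_if_reversed_monotone:
  fixes a b :: "'a::real_inner"
  assumes "a \<noteq> 0" "b \<noteq> 0" and le: "(sgn a - sgn b) \<bullet> (a - b) \<le> 0"
  shows "sgn a = sgn b"
proof -
  let ?e = "sgn a" and ?f = "sgn b"
  have ef: "?e \<bullet> ?e = 1" "?f \<bullet> ?f = 1"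
    using assms by (simp_all add: power2_norm_eq_inner[symmetric] norm_sgn)
  have ab: "a = norm a *\<^sub>R ?e" "b = norm b *\<^sub>R ?f"
    using assms by (simp_all add: sgn_div_norm)
  have "(?e - ?f) \<bullet> (a - b) = (?e - ?f) \<bullet> (norm a *\<^sub>R ?e - norm b *\<^sub>R ?f)"
    using ab by simp
  also have "\<dots> = (norm a + norm b) * (1 - ?e \<bullet> ?f)"
    using ef by (simp add: inner_diff_left inner_diff_right inner_commute algebra_simps)
  finally have "(norm a + norm b) * (1 - ?e \<bullet> ?f) \<le> 0"
    using le by simp
  moreover have "0 < norm a + norm b"
    using assms by (simp add: add_pos_pos)
  ultimately have "1 - ?e \<bullet> ?f \<le> 0"
    by (simp add: mult_le_0_iff)
  moreover have "(?e - ?f) \<bullet> (?e - ?f) = 2 * (1 - ?e \<bullet> ?f)"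
    using ef by (simp add: inner_diff_left inner_diff_right inner_commute)
  ultimately have "(?e - ?f) \<bullet> (?e - ?f) \<le> 0"
    by (metis mult_nonneg_nonpos zero_le_numeral)
  then show ?thesis
    by (metis inner_eq_zero_iff inner_ge_zero antisym right_minus_eq)
qed

lemma optimal_plan3_exchange_fst:
  assumes "optimal_plan3 \<mu> \<nu> \<gamma> L"
    and "compact (measure_support \<mu>)" "compact (measure_support \<nu>)" "compact (measure_support \<gamma>)"
    and "(x, y, z) \<in> measure_support L" "(x', y', z') \<in> measure_support L"
  shows "cost3 (x, y, z) + cost3 (x', y', z') \<le> cost3 (x', y, z) + cost3 (x, y', z')"
  using optimal_plan3_exchange[OF assms(1-4) _ _ _ _ assms(5-6), of "\<lambda>p q. (fst q, snd p)"]
  by (simp add: continuous_intros)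

text \<open>After the exchange of \<open>z\<close> and \<open>z'\<close> everything cancels except
  the cross terms of the squares, which leave twice this inner product.\<close>

lemma optimal_plan3_exchange_trd:
  assumes "optimal_plan3 \<mu> \<nu> \<gamma> L"
    and "compact (measure_support \<mu>)" "compact (measure_support \<nu>)" "compact (measure_support \<gamma>)"
    and "(x, y, z) \<in> measure_support L" "(x', y', z') \<in> measure_support L"
  shows "0 \<le> (z - z') \<bullet> ((x + y) - (x' + y'))"
proof -
  have "cost3 (x, y, z) + cost3 (x', y', z') \<le> cost3 (x, y, z') + cost3 (x', y', z)"
    using optimal_plan3_exchange[OF assms(1-4) _ _ _ _ assms(5-6),
        of "\<lambda>p q. (fst p, fst (snd p), snd (snd q))"]
    by (simp add: continuous_intros)
  then show ?thesis
    by (simp add: cost3_def power2_norm_eq_inner algebra_simps inner_commute)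
qed

lemma compact_disjoint_separated:
  fixes A B :: "'a::euclidean_space set"
  assumes "compact A" "compact B" "A \<inter> B = {}"
  obtains \<delta> where "0 < \<delta>" "\<And>x y. x \<in> A \<Longrightarrow> y \<in> B \<Longrightarrow> \<delta> \<le> norm (x - y)"
  using separate_compact_closed[OF assms(1) compact_imp_closed[OF assms(2)] assms(3)]
  by (auto simp: dist_norm)

subsection \<open>Optimal plans are concentrated on graphs\<close>

text \<open>Being a graph over the first coordinate is expressed by \<open>inj_on fst S\<close>.
  Keeping \<open>S\<close> inside the support lets the exchange inequalities apply at every one of
  its points.\<close>

lemma optimal_plan3_concentrated_on_graph:
  assumes opt: "optimal_plan3 \<mu> \<nu> \<gamma> L"
    and cpt: "compact (measure_support \<mu>)" "compact (measure_support \<nu>)" "compact (measure_support \<gamma>)"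
    and disj: "measure_support \<mu> \<inter> measure_support \<nu> = {}"
    and ac: "absolutely_continuous lborel \<mu>" "absolutely_continuous lborel \<gamma>"
  obtains S where "S \<in> sets borel" "S \<subseteq> measure_support L" "AE p in L. p \<in> S" "inj_on fst S"
proof -
  have L: "L \<in> couplings3 \<mu> \<nu> \<gamma>"
    using opt by (auto simp: optimal_plan3_def)
  let ?S = "measure_support L"
  have sub: "?S \<subseteq> measure_support \<mu> \<times> measure_support \<nu> \<times> measure_support \<gamma>"
    by (rule couplings3_support_subset[OF L])
  obtain \<delta> where \<delta>: "0 < \<delta>" "\<And>x y. x \<in> measure_support \<mu> \<Longrightarrow> y \<in> measure_support \<nu> \<Longrightarrow> \<delta> \<le> norm (x - y)"
    using compact_disjoint_separated[OF cpt(1,2) disj] by blast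
  have sep: "\<delta> \<le> norm (x - y)" if "(x, y, z) \<in> ?S" for x y z
    using sub \<delta>(2) that by blast
  have cptS: "compact ?S"
    using compact_Int_closed[OF compact_Times[OF cpt(1) compact_Times[OF cpt(2,3)]] closed_measure_support[of L]] sub
    by (simp add: Int_absorb1)
  \<comment> \<open>\<open>G\<close> is the gradient of the cost in \<open>x\<close>; semiconcavity with constant \<open>M\<close> makes \<open>M x - G\<close> monotone.\<close>
  define G where "G = (\<lambda>(x, y, z). sgn (x - y) + 2 *\<^sub>R (x - z) :: 'a)"
  \<comment> \<open>Twice the semiconcavity constant, since two semiconcavity bounds are
    added.\<close>
  define M where "M = 1 / \<delta> + 2"
  define HX where "HX = (\<lambda>p. (fst p, M *\<^sub>R fst p - G p)) ` ?S"
  define HZ where "HZ = (\<lambda>p. (snd (snd p), fst p + fst (snd p))) ` ?S"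
  define NX where "NX = {x. \<exists>p q. (x, p) \<in> HX \<and> (x, q) \<in> HX \<and> p \<noteq> q}"
  define NZ where "NZ = {x. \<exists>p q. (x, p) \<in> HZ \<and> (x, q) \<in> HZ \<and> p \<noteq> q}"
  have "NX \<in> null_sets lborel"
    unfolding NX_def
  proof (rule monotone_rel_single_valued_AE)
    have "continuous_on ?S G"
      unfolding G_def case_prod_unfold sgn_div_norm
      using sep \<delta>(1) by (intro continuous_intros) (fastforce simp: norm_eq_zero)
    then show "compact HX"
      unfolding HX_def by (intro compact_continuous_image cptS continuous_intros)
    show "monotone_rel HX"
      unfolding monotone_rel_def HX_def
    proof (clarsimp)
      fix x y z x' y' z' assume p: "(x, y, z) \<in> ?S" and q: "(x', y', z') \<in> ?S"
      let ?G = "G (x, y, z)" and ?G' = "G (x', y', z')"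
      have "cost3 (x', y, z) \<le> cost3 (x, y, z) + ?G \<bullet> (x' - x) + M / 2 * (norm (x' - x))\<^sup>2"
        using cost3_semiconcave[OF \<delta>(1) sep[OF p], of x' z] by (simp add: G_def M_def field_simps)
      moreover have "cost3 (x, y', z') \<le> cost3 (x', y', z') + ?G' \<bullet> (x - x') + M / 2 * (norm (x - x'))\<^sup>2"
        using cost3_semiconcave[OF \<delta>(1) sep[OF q], of x z'] by (simp add: G_def M_def field_simps)
      moreover have "cost3 (x, y, z) + cost3 (x', y', z') \<le> cost3 (x', y, z) + cost3 (x, y', z')"
        by (rule optimal_plan3_exchange_fst[OF opt cpt p q])
      ultimately have "0 \<le> ?G \<bullet> (x' - x) + ?G' \<bullet> (x - x') + M * (norm (x - x'))\<^sup>2"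
        by (simp add: norm_minus_commute)
      then show "0 \<le> (x - x') \<bullet> (M *\<^sub>R x - ?G - (M *\<^sub>R x' - ?G'))"
        by (simp add: power2_norm_eq_inner algebra_simps inner_commute)
    qed
  qed
  then have NX: "NX \<in> null_sets \<mu>"
    using ac by (auto simp: absolutely_continuous_def)
  have "NZ \<in> null_sets lborel"
    unfolding NZ_def
  proof (rule monotone_rel_single_valued_AE)
    show "compact HZ"
      unfolding HZ_def by (intro compact_continuous_image cptS continuous_intros)
    show "monotone_rel HZ"
      unfolding monotone_rel_def HZ_def
      using optimal_plan3_exchange_trd[OF opt cpt] by auto
  qed
  then have NZ: "NZ \<in> null_sets \<gamma>"
    using ac by (auto simp: absolutely_continuous_def)
  \<comment> \<open>The discarded points are null for \<open>L\<close>: absolute continuity of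
    \<open>\<mu>\<close> and \<open>\<gamma>\<close> makes \<open>NX\<close> and \<open>NZ\<close>
    null for the respective marginals.\<close>
  let ?R = "?S \<inter> {p. fst p \<notin> NX} \<inter> {p. snd (snd p) \<notin> NZ}"
  show ?thesis
  proof
    have "sets \<mu> = sets borel" "sets \<gamma> = sets borel"
      using couplings3D(4,6)[OF L] by auto
    then have [measurable]: "NX \<in> sets borel" "NZ \<in> sets borel"
      using NX NZ by (auto simp: null_sets_def)
    have [measurable]: "fst \<in> borel \<rightarrow>\<^sub>M (borel :: 'a measure)"
      "(\<lambda>p. snd (snd p)) \<in> borel \<rightarrow>\<^sub>M (borel :: 'a measure)"
      by (intro borel_measurable_continuous_onI continuous_intros)+
    have [measurable]: "?S \<in> sets borel"
      by (intro borel_closed closed_measure_support)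
    have "fst -` (- NX) \<inter> space borel \<in> sets (borel :: ('a \<times> 'a \<times> 'a) measure)"
      "(\<lambda>p. snd (snd p)) -` (- NZ) \<inter> space borel \<in> sets (borel :: ('a \<times> 'a \<times> 'a) measure)"
      by (rule measurable_sets, measurable)+
    then show "?R \<in> sets borel"
      by (simp add: vimage_def)
    show "AE p in L. p \<in> ?R"
      using AE_in_measure_support[OF couplings3D(2)[OF L]]
        couplings3_AE_marginal(1)[OF L AE_not_in[OF NX]] couplings3_AE_marginal(3)[OF L AE_not_in[OF NZ]]
      by eventually_elim simp
    show "inj_on fst ?R"
    proof (rule inj_onI)
      fix p q assume p: "p \<in> ?R" and q: "q \<in> ?R" and eq: "fst p = fst q"
      obtain x y z y' z' where pq: "p = (x, y, z)" "q = (x, y', z')"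
        using eq by (metis prod.collapse)
      have S: "(x, y, z) \<in> ?S" "(x, y', z') \<in> ?S" and x: "x \<notin> NX" and z: "z \<notin> NZ"
        using p q by (auto simp: pq)
      have "(x, M *\<^sub>R x - G (x, y, z)) \<in> HX" "(x, M *\<^sub>R x - G (x, y', z')) \<in> HX"
        using S unfolding HX_def by force+
      then have "M *\<^sub>R x - G (x, y, z) = M *\<^sub>R x - G (x, y', z')"
        using x unfolding NX_def by blast
      then have "G (x, y, z) = G (x, y', z')"
        by simp
      then have e: "sgn (x - y) - sgn (x - y') = 2 *\<^sub>R (z - z')"
        by (simp add: G_def algebra_simps)
      have "0 \<le> (z - z') \<bullet> ((x + y) - (x + y'))"
        by (rule optimal_plan3_exchange_trd[OF opt cpt S])
      \<comment> \<open>The sign flips because \<open>(x - y) - (x - y')\<close> is the negative of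
        \<open>y - y'\<close>.\<close>
      then have "(sgn (x - y) - sgn (x - y')) \<bullet> ((x - y) - (x - y')) \<le> 0"
        unfolding e by (simp add: algebra_simps)
      moreover have "x - y \<noteq> 0" "x - y' \<noteq> 0"
        using sep[OF S(1)] sep[OF S(2)] \<delta>(1) by auto
      ultimately have "sgn (x - y) = sgn (x - y')"
        by (intro sgn_eq_if_reversed_monotone)
      then have zz: "z = z'"
        using e by simp
      have "(z, x + y) \<in> HZ" "(z, x + y') \<in> HZ"
        using S zz unfolding HZ_def by force+
      then have "x + y = x + y'"
        using z unfolding NZ_def by blast
      then show "p = q"
        by (simp add: pq zz)
    qed
  qed auto
qed

section \<open>Borel selection of the map\<close>

text \<open>Inner regularity replaces \<open>S\<close> by a sigma-compact subset \<open>U\<close> of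
  full mass, and \<open>T\<close> is the function with graph \<open>U\<close>. Off the projection of
  \<open>U\<close> it takes the value \<open>w0\<close>, which lets its range be kept in a
  prescribed set.\<close>

lemma measurable_selection_of_graph:
  fixes L :: "('a::euclidean_space \<times> 'b::euclidean_space) measure"
  assumes "prob_space L" and L: "sets L = sets borel"
    and S: "S \<in> sets borel" "AE p in L. p \<in> S" "inj_on fst S"
  obtains T where "T \<in> borel_measurable borel" "AE p in L. snd p = T (fst p)"
    "\<And>x. (x, T x) \<in> S \<or> T x = w0"
proof -
  interpret prob_space L by fact
  have "emeasure L S = 1"
    using S L by (intro emeasure_eq_1_AE) auto
  have "\<exists>K. compact K \<and> K \<subseteq> S \<and> 1 - 1 / Suc n < measure L K" for n
  proof -
    have "ennreal (1 - 1 / Suc n) < emeasure L S"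
      unfolding \<open>emeasure L S = 1\<close> by (simp add: ennreal_less_one_iff)
    also have "emeasure L S = (SUP K \<in> {K. K \<subseteq> S \<and> compact K}. emeasure L K)"
      by (rule inner_regular) (use L S in auto)
    finally obtain K where "K \<subseteq> S" "compact K" "ennreal (1 - 1 / Suc n) < emeasure L K"
      by (auto simp: less_SUP_iff)
    then show ?thesis
      by (auto simp: emeasure_eq_measure ennreal_less_iff)
  qed
  then obtain K where K: "\<And>n. compact (K n)" "\<And>n. K n \<subseteq> S" "\<And>n. 1 - 1 / Suc n < measure L (K n)"
    by metis
  \<comment> \<open>Projections of \<open>\<sigma>\<close>-compact sets are Borel, unlike those of general Borel sets.\<close>
  define U where "U = (\<Union>n. K n)"
  have U: "U \<in> sets L"
    unfolding U_def using K(1) by (simp add: L borel_compact sets.countable_UN image_subset_iff)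
  have "1 \<le> measure L U"
  proof (rule LIMSEQ_le_const2)
    show "(\<lambda>n. 1 - 1 / Suc n) \<longlonglongrightarrow> (1::real)"
      using tendsto_diff[OF tendsto_const[of "1::real"] LIMSEQ_inverse_real_of_nat]
      by (simp add: inverse_eq_divide)
    have "measure L (K n) \<le> measure L U" for n
      using U by (intro finite_measure_mono) (auto simp: U_def)
    then show "\<exists>N. \<forall>n\<ge>N. 1 - 1 / Suc n \<le> measure L U"
      using K(3) by (meson less_imp_le order_trans)
  qed
  then have AE_U: "AE p in L. p \<in> U"
    using U by (intro AE_in_set_eq_1[THEN iffD2]) (auto intro: antisym)
  have US: "U \<subseteq> S"
    using K(2) by (auto simp: U_def)
  define T where "T x = (if x \<in> fst ` U then THE w. (x, w) \<in> U else w0)" for x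
  have T_eq: "T x = w" if "(x, w) \<in> U" for x w
  proof -
    have "(THE w. (x, w) \<in> U) = w"
      using that US inj_onD[OF S(3)] by (intro the_equality) fastforce+
    then show ?thesis
      using that by (force simp: T_def)
  qed
  have fst_closed: "fst ` (U \<inter> (UNIV \<times> C)) \<in> sets borel" if "closed C" for C
  proof -
    have "fst ` (U \<inter> (UNIV \<times> C)) = (\<Union>n. fst ` (K n \<inter> (UNIV \<times> C)))"
      by (auto simp: U_def)
    moreover have "compact (fst ` (K n \<inter> (UNIV \<times> C)))" for n
      using K(1) that by (intro compact_continuous_image compact_Int_closed continuous_intros closed_Times) auto
    ultimately show ?thesis
      by (simp add: borel_compact sets.countable_UN image_subset_iff)
  qed
  show ?thesis
  proof
    show "T \<in> borel_measurable borel"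
    proof (rule borel_measurableI)
      fix V :: "'b set" assume "open V"
      then have cl: "closed (- V)" by (simp add: open_closed)
      \<comment> \<open>The first piece is the projection of a closed slice of \<open>U\<close>; the
        second is the region where \<open>T\<close> takes its default value.\<close>
      have "T -` (- V) = fst ` (U \<inter> (UNIV \<times> - V)) \<union> (if w0 \<in> V then {} else - fst ` (U \<inter> (UNIV \<times> UNIV)))"
        by (auto simp: T_eq T_def[of x for x] split: if_splits)
          (metis T_def T_eq ComplI IntI SigmaI UNIV_I fst_conv image_eqI)+
      moreover have "\<dots> \<in> sets borel"
        using fst_closed[OF cl] fst_closed[of UNIV] by auto
      ultimately have "- (T -` (- V)) \<in> sets borel"
        by (metis borel_comp)
      then show "T -` V \<inter> space borel \<in> sets borel"
        by (simp add: vimage_Compl)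
    qed
    show "AE p in L. snd p = T (fst p)"
      using AE_U by eventually_elim (auto simp: T_eq)
    show "(x, T x) \<in> S \<or> T x = w0" for x
    proof (cases "x \<in> fst ` U")
      case True
      then obtain w where w: "(x, w) \<in> U" by auto
      with US show ?thesis by (auto simp: T_eq[OF w])
    qed (simp add: T_def)
  qed
qed

subsection \<open>Weak compactness\<close>

text \<open>Truncated multiples of the distance to the complement converge to the indicator of an
  open set, and open sets form an intersection-stable generator.\<close>

lemma borel_measure_eqI_continuous:
  fixes M N :: "'a::metric_space measure"
  assumes "prob_space M" "prob_space N" and sets: "sets M = sets borel" "sets N = sets borel"
    and eq: "\<And>f :: 'a \<Rightarrow> real. continuous_on UNIV f \<Longrightarrow> (\<And>x. 0 \<le> f x \<and> f x \<le> 1) \<Longrightarrow> integral\<^sup>L M f = integral\<^sup>L N f"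
  shows "M = N"
proof -
  interpret M: prob_space M by fact
  interpret N: prob_space N by fact
  have space: "space M = UNIV" "space N = UNIV"
    using sets_eq_imp_space_eq[OF sets(1)] sets_eq_imp_space_eq[OF sets(2)] by auto
  show ?thesis
  proof (rule measure_eqI_generator_eq[where E = "{S. open S}" and \<Omega> = UNIV and A = "\<lambda>_. UNIV"])
    fix U :: "'a set" assume "U \<in> {S. open S}"
    then have U: "open U" by simp
    show "emeasure M U = emeasure N U"
    \<comment> \<open>The whole space is treated apart because \<open>infdist\<close> to the empty
      set is 0 by convention.\<close>
    proof (cases "U = UNIV")
      case True
      then show ?thesis
        using M.emeasure_space_1 N.emeasure_space_1 by (simp add: space)
    next
      case False
      define f where "f k x = min 1 (real k * infdist x (- U))" for k x
      have cont: "continuous_on UNIV (f k)" for k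
        unfolding f_def by (intro continuous_intros)
      have f01: "0 \<le> f k x \<and> f k x \<le> 1" for k x
        by (auto simp: f_def infdist_nonneg)
      have lim: "(\<lambda>k. f k x) \<longlonglongrightarrow> indicator U x" for x
      proof (cases "x \<in> U")
        case True
        then have "infdist x (- U) > 0"
          using False U by (metis ComplD Compl_UNIV_eq closed_Compl double_complement infdist_nonneg
              in_closed_iff_infdist_zero less_eq_real_def)
        then have "filterlim (\<lambda>k. real k * infdist x (- U)) at_top sequentially"
          by (intro filterlim_at_top_mult_tendsto_pos[OF tendsto_const _ filterlim_real_sequentially])
        then have "eventually (\<lambda>k. 1 \<le> real k * infdist x (- U)) sequentially"
          by (simp add: filterlim_at_top)
        then have "eventually (\<lambda>k. f k x = indicator U x) sequentially"
          by eventually_elim (simp add: f_def True)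
        then show ?thesis
          by (rule tendsto_eventually)
      next
        case False
        then show ?thesis by (simp add: f_def infdist_zero)
      qed
      have conv: "(\<lambda>k. integral\<^sup>L P (f k)) \<longlonglongrightarrow> measure P U"
        if P: "prob_space P" "sets P = sets borel" for P
      proof -
        interpret P: prob_space P by fact
        have "(\<lambda>k. integral\<^sup>L P (f k)) \<longlonglongrightarrow> integral\<^sup>L P (indicator U)"
        proof (rule integral_dominated_convergence[where w = "\<lambda>_. 1"])
          show "f k \<in> borel_measurable P" for k
            using borel_measurable_continuous_onI[OF cont] by (simp add: measurable_cong_sets[OF P(2) refl])
          show "AE x in P. norm (f k x) \<le> 1" for k
            using f01 by (auto simp: abs_le_iff intro: order_trans[of _ 0])
          show "(indicator U :: _ \<Rightarrow> real) \<in> borel_measurable P"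
            using U by (intro borel_measurable_indicator) (simp add: P)
        qed (use lim in auto)
        then show ?thesis
          using sets_eq_imp_space_eq[OF P(2)] by simp
      qed
      have "measure M U = measure N U"
        using conv[of M] conv[of N] eq[OF cont f01] assms(1-4) LIMSEQ_unique by simp
      then show ?thesis
        by (simp add: M.emeasure_eq_measure N.emeasure_eq_measure)
    qed
  qed (auto simp: Int_stable_def sets sets_borel M.emeasure_eq_measure)
qed

section \<open>Coding points of a compact set by real numbers\<close>

text \<open>At the first differing index \<open>n\<close> the digits contribute
  \<open>(1/3)^n\<close>, while all later ones together contribute at most half of that. Base 3 with
  digits 0 and 1 leaves this margin, which base 2 would not.\<close>

lemma ternary_digits_eq:
  fixes a b :: "nat \<Rightarrow> real"
  assumes ab: "\<And>k. a k \<in> {0, 1}" "\<And>k. b k \<in> {0, 1}"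
    and close: "\<bar>(\<Sum>k. a k * (1/3)^k) - (\<Sum>k. b k * (1/3)^k)\<bar> < (1/3)^m / 2"
    and "k \<le> m"
  shows "a k = b k"
proof (rule ccontr)
  assume "a k \<noteq> b k"
  define n where "n = (LEAST k. a k \<noteq> b k)"
  have n: "a n \<noteq> b n" "\<And>j. j < n \<Longrightarrow> a j = b j"
    unfolding n_def using LeastI[of "\<lambda>k. a k \<noteq> b k", OF \<open>a k \<noteq> b k\<close>] not_less_Least by blast+
  have "n \<le> m"
    using \<open>a k \<noteq> b k\<close> \<open>k \<le> m\<close> unfolding n_def by (meson Least_le order_trans)
  have geo: "summable (\<lambda>k. (1/3::real)^k)" by (rule summable_geometric) simp
  have sa: "summable (\<lambda>k. a k * (1/3)^k)" and sb: "summable (\<lambda>k. b k * (1/3)^k)"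
    using ab by (auto intro!: summable_comparison_test'[OF geo, of 0] simp: abs_mult mult_le_cancel_right1)
      (metis ab insertE singletonD abs_zero abs_one zero_le_one order_refl)+
  define d where "d k = (a k - b k) * (1/3)^k" for k
  have sd: "summable d"
    unfolding d_def using summable_diff[OF sa sb] by (simp add: left_diff_distrib)
  have d_le: "\<bar>d k\<bar> \<le> (1/3)^k" for k
    using ab(1)[of k] ab(2)[of k] by (auto simp: d_def)
  have "suminf d = (\<Sum>k. a k * (1/3)^k) - (\<Sum>k. b k * (1/3)^k)"
    unfolding d_def using suminf_diff[OF sa sb] by (simp add: left_diff_distrib)
  then have small: "\<bar>suminf d\<bar> < (1/3)^m / 2"
    using close by simp
  have "suminf d = (\<Sum>k. d (k + Suc n)) + (\<Sum>k<Suc n. d k)"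
    by (rule suminf_split_initial_segment[OF sd])
  also have "(\<Sum>k<Suc n. d k) = d n"
    using n(2) by (simp add: d_def)
  finally have split: "suminf d = (\<Sum>k. d (k + Suc n)) + d n" .
  have geo': "summable (\<lambda>k. (1/3::real)^(k + Suc n))"
    using geo by (rule summable_ignore_initial_segment)
  have "\<bar>\<Sum>k. d (k + Suc n)\<bar> \<le> (\<Sum>k. (1/3::real)^(k + Suc n))"
    using norm_suminf_le[of "\<lambda>k. d (k + Suc n)" "\<lambda>k. (1/3)^(k + Suc n)", OF _ geo'] d_le
    by (simp del: power_Suc add_Suc_right)
  also have "\<dots> = (1/3)^Suc n * (\<Sum>k. (1/3::real)^k)"
    using suminf_mult[OF geo, of "(1/3)^Suc n"] by (simp add: power_add mult.commute)
  also have "\<dots> = (1/3)^n / 2"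
    by (subst suminf_geometric) auto
  finally have tail: "\<bar>\<Sum>k. d (k + Suc n)\<bar> \<le> (1/3)^n / 2" .
  have "\<bar>d n\<bar> = (1/3)^n"
    using n(1) ab(1)[of n] ab(2)[of n] by (auto simp: d_def)
  then have "(1/3)^n / 2 \<le> \<bar>suminf d\<bar>"
    using tail split by linarith
  moreover have "(1/3::real)^m \<le> (1/3)^n"
    using \<open>n \<le> m\<close> by (intro power_decreasing) auto
  ultimately show False
    using small by linarith
qed

lemma compact_real_coding:
  fixes K :: "'a::euclidean_space set"
  assumes K: "compact K"
  obtains s :: "'a \<Rightarrow> real" and g :: "real \<Rightarrow> 'a"
  where "s \<in> borel_measurable borel" "\<And>p. 0 \<le> s p \<and> s p \<le> 2" "continuous_on UNIV g" "bounded (range g)"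
    "\<And>p. p \<in> K \<Longrightarrow> g (s p) = p"
proof (cases "K = {}")
  case True
  show ?thesis
    by (rule that[of "\<lambda>_. 0" "\<lambda>_. 0"]) (auto simp: True)
next
  case False
  \<comment> \<open>Encode a point by the ternary digits telling in which balls of a countable family it lies; finitely
    many digits locate it up to \<open>\<epsilon>\<close>, so the decoding is uniformly continuous.\<close>
  have "\<exists>F. finite F \<and> K \<subseteq> (\<Union>x\<in>F. ball x (1 / Suc j))" for j
    using compactE_image[OF K, of K "\<lambda>x. ball x (1 / Suc j)"]
    by (metis centre_in_ball UN_I open_ball subsetI zero_less_divide_1_iff of_nat_0_less_iff zero_less_Suc)
  then obtain F where F: "\<And>j. finite (F j)" "\<And>j. K \<subseteq> (\<Union>x\<in>F j. ball x (1 / Suc j))"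
    by metis
  define \<B> where "\<B> = (\<Union>j. (\<lambda>x. ball x (1 / Suc j)) ` F j)"
  have cnt: "countable \<B>"
    unfolding \<B>_def by (intro countable_UN countableI_type countable_image countable_finite F(1))
  have "F 0 \<noteq> {}"
    using False F(2)[of 0] by auto
  then have ne: "\<B> \<noteq> {}"
    unfolding \<B>_def by blast
  define B where "B = from_nat_into \<B>"
  have rng: "range B = \<B>"
    unfolding B_def by (rule range_from_nat_into[OF ne cnt])
  have B_meas[measurable]: "B k \<in> sets borel" for k
    using rangeI[of B k] by (auto simp: rng \<B>_def)
  have geo: "summable (\<lambda>k. (1/3::real)^k)" by (rule summable_geometric) simp
  define s where "s p = (\<Sum>k. indicator (B k) p * (1/3::real)^k)" for p
  have s_summable: "summable (\<lambda>k. indicator (B k) p * (1/3::real)^k)" for p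
    by (rule summable_comparison_test'[OF geo, of 0]) (auto simp: indicator_def)
  have s_meas: "s \<in> borel_measurable borel"
    unfolding s_def by measurable
  have s_bound: "0 \<le> s p \<and> s p \<le> 2" for p
  proof
    show "0 \<le> s p"
      unfolding s_def by (intro suminf_nonneg s_summable) auto
    have "s p \<le> (\<Sum>k. (1/3::real)^k)"
      unfolding s_def by (intro suminf_le s_summable geo) (auto simp: indicator_def)
    also have "\<dots> \<le> 2"
      by (subst suminf_geometric) auto
    finally show "s p \<le> 2" .
  qed
  have uc: "\<exists>\<delta>>0. \<forall>p\<in>K. \<forall>q\<in>K. \<bar>s p - s q\<bar> < \<delta> \<longrightarrow> dist p q < \<epsilon>" if eps: "\<epsilon> > 0" for \<epsilon> :: real
  proof -
    obtain j where j: "1 / Suc j < \<epsilon> / 2"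
      by (rule nat_approx_posE[OF half_gt_zero[OF eps]])
    have "\<forall>x\<in>F j. ball x (1 / Suc j) \<in> range B"
      unfolding rng \<B>_def by blast
    then have "\<forall>x\<in>F j. \<exists>k. B k = ball x (1 / Suc j)"
      by (metis rangeE)
    then obtain k where k: "\<And>x. x \<in> F j \<Longrightarrow> B (k x) = ball x (1 / Suc j)"
      by metis
    \<comment> \<open>Agreement of the digits up to \<open>m\<close> decides membership in every
      ball of the cover of radius \<open>1 / Suc j\<close>, so \<open>p\<close> and \<open>q\<close>
      share one of these balls.\<close>
    define m where "m = Max (insert 0 (k ` F j))"
    have m: "k x \<le> m" if "x \<in> F j" for x
      unfolding m_def using F(1) that by (intro Max_ge) auto
    show ?thesis
    proof (intro exI conjI ballI impI)
      show "0 < (1/3::real)^m / 2" by simp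
      fix p q assume pq: "p \<in> K" "q \<in> K" and close: "\<bar>s p - s q\<bar> < (1/3)^m / 2"
      obtain x where x: "x \<in> F j" "p \<in> ball x (1 / Suc j)"
        using F(2) pq(1) by blast
      have "(indicator (B (k x)) p :: real) = indicator (B (k x)) q"
        by (rule ternary_digits_eq[OF _ _ close[unfolded s_def] m[OF x(1)]]) (auto simp: indicator_def)
      then have "q \<in> ball x (1 / Suc j)"
        using x k[OF x(1)] by (auto simp: indicator_def split: if_splits)
      then show "dist p q < \<epsilon>"
        using x(2) j dist_triangle[of p q x] by (simp add: dist_commute)
    qed
  qed
  have inj: "inj_on s K"
  proof (rule inj_onI, rule ccontr)
    fix p q assume pq: "p \<in> K" "q \<in> K" "s p = s q" "p \<noteq> q"
    then obtain \<delta> where "\<delta> > 0" "\<forall>p'\<in>K. \<forall>q'\<in>K. \<bar>s p' - s q'\<bar> < \<delta> \<longrightarrow> dist p' q' < dist p q"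
      using uc[of "dist p q"] by auto
    with pq show False by fastforce
  qed
  define h where "h = inv_into K s"
  have hs: "h (s p) = p" if "p \<in> K" for p
    unfolding h_def using inj that by (rule inv_into_f_f)
  have "uniformly_continuous_on (s ` K) h"
    unfolding uniformly_continuous_on_def
  proof (intro allI impI)
    fix \<epsilon> :: real assume "\<epsilon> > 0"
    from uc[OF this] obtain \<delta> where \<delta>: "\<delta> > 0" "\<forall>p\<in>K. \<forall>q\<in>K. \<bar>s p - s q\<bar> < \<delta> \<longrightarrow> dist p q < \<epsilon>"
      by blast
    then show "\<exists>d>0. \<forall>x\<in>s ` K. \<forall>x'\<in>s ` K. dist x' x < d \<longrightarrow> dist (h x') (h x) < \<epsilon>"
      by (intro exI[of _ \<delta>]) (auto simp: hs dist_real_def)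
  qed
  then obtain g0 where g0: "uniformly_continuous_on (closure (s ` K)) g0" "\<And>x. x \<in> s ` K \<Longrightarrow> h x = g0 x"
    by (rule uniformly_continuous_on_extension_on_closure) blast
  have cont0: "continuous_on (closure (s ` K)) g0"
    using g0(1) by (rule uniformly_continuous_imp_continuous)
  have "bounded (s ` K)"
    using s_bound by (intro boundedI[of _ 2]) (auto simp: abs_le_iff intro: order_trans[of _ 0])
  then have "compact (g0 ` closure (s ` K))"
    by (intro compact_continuous_image cont0) (simp add: compact_closure)
  then obtain b where "b > 0" and b: "\<And>x. x \<in> closure (s ` K) \<Longrightarrow> norm (g0 x) \<le> b"
    using compact_imp_bounded bounded_pos by (metis imageI)
  obtain g where g: "continuous_on UNIV g" "\<And>x. x \<in> closure (s ` K) \<Longrightarrow> g x = g0 x" "\<And>x. norm (g x) \<le> b"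
    using Tietze[OF cont0, of UNIV b] b \<open>b > 0\<close> by auto
  show ?thesis
  proof (rule that[OF s_meas s_bound g(1)])
    show "bounded (range g)"
      using g(3) by (intro boundedI[of _ b]) auto
    fix p assume "p \<in> K"
    then show "g (s p) = p"
      using g(2)[of "s p"] g0(2)[of "s p"] hs[of p] closure_subset[of "s ` K"] by auto
  qed
qed

text \<open>The laws of the codes \<open>s\<close> live in a fixed bounded interval, so a
  subsequence converges weakly on the line. Its limit is pushed back by the decoder
  \<open>g\<close>, defined and continuous on all reals; \<open>g\<close> inverts \<open>s\<close>
  on \<open>K\<close>, hence almost everywhere.\<close>

lemma compact_weakly_convergent_subsequence:
  fixes L :: "nat \<Rightarrow> 'a::euclidean_space measure"
  assumes prob: "\<And>n. prob_space (L n)" and sets: "\<And>n. sets (L n) = sets borel"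
    and K: "compact K" "\<And>n. AE p in L n. p \<in> K"
  obtains r M where "strict_mono r" "prob_space M" "sets M = sets borel"
    "\<And>f :: 'a \<Rightarrow> real. continuous_on UNIV f \<Longrightarrow> (\<lambda>n. integral\<^sup>L (L (r n)) f) \<longlonglongrightarrow> integral\<^sup>L M f"
proof -
  obtain s :: "'a \<Rightarrow> real" and g where s[measurable]: "s \<in> borel_measurable borel"
    and s_bound: "\<And>p. 0 \<le> s p \<and> s p \<le> 2" and g: "continuous_on UNIV g" "bounded (range g)"
    and gs: "\<And>p. p \<in> K \<Longrightarrow> g (s p) = p"
    using compact_real_coding[OF K(1)] by metis
  have s_L: "s \<in> borel_measurable (L n)" for n
    using s by (simp add: measurable_cong_sets[OF sets refl])
  have g_meas[measurable]: "g \<in> borel_measurable borel"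
    by (rule borel_measurable_continuous_onI[OF g(1)])
  define R where "R n = distr (L n) borel s" for n
  have R: "real_distribution (R n)" for n
    unfolding R_def using prob s_L by (intro prob_space.real_distribution_distr)
  \<comment> \<open>Tightness is stated with half-open intervals; the left end -1 keeps the code 0
    inside.\<close>
  have "measure (R n) {-1<..2} = 1" for n
  proof -
    interpret prob_space "L n" by (rule prob)
    have "-1 < s p" for p
      using s_bound[of p] by linarith
    then have "s -` {-1<..2} \<inter> space (L n) = space (L n)"
      using s_bound by auto
    then show ?thesis
      unfolding R_def using s_L by (subst measure_distr) (auto simp: prob_space)
  qed
  then have "tight R"
    unfolding tight_def using R by (intro conjI allI impI exI[of _ "-1"] exI[of _ "2"]) auto
  from tight_imp_convergent_subsubsequence[OF this strict_mono_id]
  obtain r M where r: "strict_mono r" and M: "real_distribution M" and conv: "weak_conv_m (R \<circ> r) M"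
    by (auto simp: comp_def)
  interpret M: real_distribution M by fact
  show ?thesis
  proof (rule that[of r "distr M borel g"])
    show "prob_space (distr M borel g)"
      by (rule M.prob_space_distr) simp
    fix f :: "'a \<Rightarrow> real" assume f: "continuous_on UNIV f"
    have f_meas[measurable]: "f \<in> borel_measurable borel"
      by (rule borel_measurable_continuous_onI[OF f])
    have fg: "continuous_on UNIV (\<lambda>x. f (g x))"
      by (rule continuous_on_compose2[OF f g(1)]) auto
    have "compact (f ` closure (range g))"
      using g(2) by (intro compact_continuous_image continuous_on_subset[OF f]) (auto simp: compact_closure)
    then obtain b where b: "\<And>y. y \<in> closure (range g) \<Longrightarrow> norm (f y) \<le> b"
      by (meson compact_imp_bounded bounded_iff imageI)
    have "(\<lambda>n. integral\<^sup>L ((R \<circ> r) n) (\<lambda>x. f (g x))) \<longlonglongrightarrow> integral\<^sup>L M (\<lambda>x. f (g x))"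
    proof (rule weak_conv_imp_integral_bdd_continuous_conv[OF _ M conv])
      show "isCont (\<lambda>x. f (g x)) x" for x
        using fg by (simp add: continuous_on_eq_continuous_at)
      show "norm (f (g x)) \<le> b" for x
        using closure_subset[of "range g"] by (intro b) auto
    qed (use R in auto)
    moreover have "integral\<^sup>L ((R \<circ> r) n) (\<lambda>x. f (g x)) = integral\<^sup>L (L (r n)) f" for n
    proof -
      have "integral\<^sup>L ((R \<circ> r) n) (\<lambda>x. f (g x)) = (\<integral>p. f (g (s p)) \<partial>L (r n))"
        unfolding R_def comp_def by (rule integral_distr) (use s_L in measurable)
      also have "\<dots> = integral\<^sup>L (L (r n)) f"
      proof (rule integral_cong_AE)
        show "AE p in L (r n). f (g (s p)) = f p"
          using K(2)[of "r n"] by eventually_elim (simp add: gs)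
      qed (auto simp: measurable_cong_sets[OF sets refl])
      finally show ?thesis .
    qed
    moreover have "integral\<^sup>L (distr M borel g) f = integral\<^sup>L M (\<lambda>x. f (g x))"
      by (rule integral_distr) auto
    ultimately show "(\<lambda>n. integral\<^sup>L (L (r n)) f) \<longlonglongrightarrow> integral\<^sup>L (distr M borel g) f"
      by simp
  qed (use r in auto)
qed

subsection \<open>Existence of optimal plans\<close>

lemma distr_pair_snd:
  assumes "prob_space N" "sigma_finite_measure M"
  shows "distr (N \<Otimes>\<^sub>M M) M snd = M"
proof (rule measure_eqI)
  interpret N: prob_space N by fact
  interpret M: sigma_finite_measure M by fact
  fix A assume A: "A \<in> sets (distr (N \<Otimes>\<^sub>M M) M snd)"
  then have "emeasure (distr (N \<Otimes>\<^sub>M M) M snd) A = emeasure (N \<Otimes>\<^sub>M M) (space N \<times> A)"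
    by (auto simp add: emeasure_distr space_pair_measure dest: sets.sets_into_space intro!: arg_cong2[where f=emeasure])
  with A show "emeasure (distr (N \<Otimes>\<^sub>M M) M snd) A = emeasure M A"
    by (simp add: M.emeasure_pair_measure_Times N.emeasure_space_1)
qed simp

lemma distr_cong_sets:
  "sets N = sets N' \<Longrightarrow> distr M N f = distr M N' f"
  by (rule distr_cong[OF refl _ refl])

lemma product_in_couplings3:
  assumes "prob_space \<mu>" "prob_space \<nu>" "prob_space \<gamma>"
    and sets: "sets \<mu> = sets borel" "sets \<nu> = sets borel" "sets \<gamma> = sets borel"
  shows "\<mu> \<Otimes>\<^sub>M (\<nu> \<Otimes>\<^sub>M \<gamma>) \<in> couplings3 \<mu> \<nu> \<gamma>"
proof -
  interpret \<mu>: prob_space \<mu> by fact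
  interpret \<nu>: prob_space \<nu> by fact
  interpret \<gamma>: prob_space \<gamma> by fact
  interpret Q: pair_prob_space \<nu> \<gamma> ..
  interpret P: pair_prob_space \<mu> "\<nu> \<Otimes>\<^sub>M \<gamma>" ..
  let ?P = "\<mu> \<Otimes>\<^sub>M (\<nu> \<Otimes>\<^sub>M \<gamma>)"
  have snd: "distr ?P (\<nu> \<Otimes>\<^sub>M \<gamma>) snd = \<nu> \<Otimes>\<^sub>M \<gamma>"
    by (rule distr_pair_snd) unfold_locales
  have "distr ?P borel fst = distr ?P \<mu> fst"
    by (rule distr_cong_sets) (simp add: sets)
  also have "\<dots> = \<mu>"
    by (rule Q.distr_pair_fst)
  finally have 1: "distr ?P borel fst = \<mu>" .
  have "distr ?P borel (\<lambda>p. fst (snd p)) = distr ?P \<nu> (fst \<circ> snd)"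
    using sets by (intro distr_cong) auto
  also have "\<dots> = distr (distr ?P (\<nu> \<Otimes>\<^sub>M \<gamma>) snd) \<nu> fst"
    by (rule distr_distr[symmetric]) measurable
  also have "\<dots> = \<nu>"
    unfolding snd by (rule \<gamma>.distr_pair_fst)
  finally have 2: "distr ?P borel (\<lambda>p. fst (snd p)) = \<nu>" .
  have "distr ?P borel (\<lambda>p. snd (snd p)) = distr ?P \<gamma> (snd \<circ> snd)"
    using sets by (intro distr_cong) auto
  also have "\<dots> = distr (distr ?P (\<nu> \<Otimes>\<^sub>M \<gamma>) snd) \<gamma> snd"
    by (rule distr_distr[symmetric]) measurable
  also have "\<dots> = \<gamma>"
    unfolding snd by (rule distr_pair_snd) unfold_locales
  finally have 3: "distr ?P borel (\<lambda>p. snd (snd p)) = \<gamma>" .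
  show ?thesis
    unfolding couplings3_def
    using 1 2 3 P.prob_space_axioms sets_pair_measure_borel[OF sets(1) sets_pair_measure_borel[OF sets(2,3)]]
    by simp
qed

text \<open>Marginals survive weak limits: the integrals of \<open>f\<close> composed with
  \<open>\<pi>\<close> are constant along the sequence, and continuous functions determine the
  measure.\<close>

lemma weak_limit_distr_eq:
  fixes M :: "'b::topological_space measure" and \<pi> :: "'b \<Rightarrow> 'a::metric_space"
  assumes "prob_space \<rho>" "sets \<rho> = sets borel" "prob_space M" "sets M = sets borel"
    and \<pi>: "continuous_on UNIV \<pi>"
    and L: "\<And>n. sets (L n) = sets borel" "\<And>n. distr (L n) borel \<pi> = \<rho>"
    and lim: "\<And>f :: 'b \<Rightarrow> real. continuous_on UNIV f \<Longrightarrow> (\<lambda>n. integral\<^sup>L (L n) f) \<longlonglongrightarrow> integral\<^sup>L M f"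
  shows "distr M borel \<pi> = \<rho>"
proof (rule borel_measure_eqI_continuous)
  have meas: "\<pi> \<in> borel_measurable P" if "sets P = sets borel" for P
    using borel_measurable_continuous_onI[OF \<pi>] by (simp add: measurable_cong_sets[OF that refl])
  show "prob_space (distr M borel \<pi>)"
    using assms(3) meas[OF assms(4)] by (rule prob_space.prob_space_distr)
  fix f :: "'a \<Rightarrow> real" assume f: "continuous_on UNIV f"
  have fm: "f \<in> borel_measurable borel"
    using f by (rule borel_measurable_continuous_onI)
  have f\<pi>: "continuous_on UNIV (\<lambda>p. f (\<pi> p))"
    by (rule continuous_on_compose2[OF f \<pi>]) auto
  have "integral\<^sup>L (L n) (\<lambda>p. f (\<pi> p)) = integral\<^sup>L \<rho> f" for n
    using integral_distr[OF meas[OF L(1)] fm, of n] L(2)[of n] by simp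
  then have "(\<lambda>n. integral\<^sup>L \<rho> f) \<longlonglongrightarrow> integral\<^sup>L M (\<lambda>p. f (\<pi> p))"
    using lim[OF f\<pi>] by simp
  then have "integral\<^sup>L \<rho> f = integral\<^sup>L M (\<lambda>p. f (\<pi> p))"
    by (simp add: LIMSEQ_const_iff)
  then show "integral\<^sup>L (distr M borel \<pi>) f = integral\<^sup>L \<rho> f"
    using integral_distr[OF meas[OF assms(4)] fm] by simp
qed (use assms in auto)

text \<open>Direct method: a minimising sequence of couplings has a weakly convergent subsequence,
  its limit is a coupling, and the continuous cost passes to the limit.\<close>

lemma optimal_plan3_exists:
  assumes prob: "prob_space \<mu>" "prob_space \<nu>" "prob_space \<gamma>"
    and sets: "sets \<mu> = sets borel" "sets \<nu> = sets borel" "sets \<gamma> = sets borel"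
    and cpt: "compact (measure_support \<mu>)" "compact (measure_support \<nu>)" "compact (measure_support \<gamma>)"
  shows "\<exists>L. optimal_plan3 \<mu> \<nu> \<gamma> L"
proof -
  define V where "V = (\<lambda>L. integral\<^sup>L L cost3) ` couplings3 \<mu> \<nu> \<gamma>"
  have ne: "V \<noteq> {}"
    using product_in_couplings3[OF prob sets] by (auto simp: V_def)
  have bdd: "bdd_below V"
    by (rule bdd_belowI[of _ 0]) (auto simp: V_def cost3_def intro!: integral_nonneg_AE)
  have "\<exists>L\<in>couplings3 \<mu> \<nu> \<gamma>. integral\<^sup>L L cost3 < Inf V + 1 / Suc n" for n
    using cInf_lessD[OF ne, of "Inf V + 1 / Suc n"] by (auto simp: V_def)
  then obtain L where L: "\<And>n. L n \<in> couplings3 \<mu> \<nu> \<gamma>" "\<And>n. integral\<^sup>L (L n) cost3 < Inf V + 1 / Suc n"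
    by metis
  obtain r M where r: "strict_mono r" and M: "prob_space M" "sets M = sets borel"
    and lim: "\<And>f. continuous_on UNIV f \<Longrightarrow> (\<lambda>n. integral\<^sup>L (L (r n)) f :: real) \<longlonglongrightarrow> integral\<^sup>L M f"
    using that by (rule compact_weakly_convergent_subsequence[where L = L, OF couplings3D(1)[OF L(1)] couplings3D(2)[OF L(1)]
        compact_Times[OF cpt(1) compact_Times[OF cpt(2,3)]] couplings3_AE_supports[OF L(1)]])
  note limit = weak_limit_distr_eq[OF _ _ M _ couplings3D(2)[OF L(1)] _ lim]
  have "M \<in> couplings3 \<mu> \<nu> \<gamma>"
    unfolding couplings3_def
  proof (intro CollectI conjI M)
    show "distr M borel fst = \<mu>"
      by (rule limit[OF prob(1) sets(1) _ couplings3D(4)[OF L(1)]]) (intro continuous_intros)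
    show "distr M borel (\<lambda>p. fst (snd p)) = \<nu>"
      by (rule limit[OF prob(2) sets(2) _ couplings3D(5)[OF L(1)]]) (intro continuous_intros)
    show "distr M borel (\<lambda>p. snd (snd p)) = \<gamma>"
      by (rule limit[OF prob(3) sets(3) _ couplings3D(6)[OF L(1)]]) (intro continuous_intros)
  qed
  moreover have "integral\<^sup>L M cost3 \<le> Inf V"
  proof (rule LIMSEQ_le[OF lim[OF continuous_on_cost3]])
    have "(\<lambda>n. Inf V + 1 / Suc n) \<longlonglongrightarrow> Inf V + 0"
      by (intro tendsto_add tendsto_const LIMSEQ_Suc[OF lim_1_over_n])
    from LIMSEQ_subseq_LIMSEQ[OF this r]
    show "(\<lambda>n. Inf V + 1 / Suc (r n)) \<longlonglongrightarrow> Inf V"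
      by (simp add: comp_def)
    show "\<exists>N. \<forall>n\<ge>N. integral\<^sup>L (L (r n)) cost3 \<le> Inf V + 1 / Suc (r n)"
      using L(2) by (meson less_imp_le)
  qed
  moreover have "Inf V \<le> integral\<^sup>L L' cost3" if "L' \<in> couplings3 \<mu> \<nu> \<gamma>" for L'
    using that by (intro cInf_lower bdd) (auto simp: V_def)
  ultimately show ?thesis
    by (force simp: optimal_plan3_def intro: order_trans)
qed

subsection \<open>Uniqueness\<close>

text \<open>\<open>L\<close> is the average of the two plans, realised by a fair coin through
  \<open>bind\<close>. Marginals and cost are affine in the plan, so \<open>L\<close> is optimal;
  what holds almost everywhere for \<open>L\<close> holds so for both halves.\<close>

lemma optimal_plan3_mixture:
  fixes L1 L2 :: "('a::euclidean_space \<times> 'a \<times> 'a) measure"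
  assumes opt: "optimal_plan3 \<mu> \<nu> \<gamma> L1" "optimal_plan3 \<mu> \<nu> \<gamma> L2"
    and cpt: "compact (measure_support \<mu>)" "compact (measure_support \<nu>)" "compact (measure_support \<gamma>)"
  obtains L where "optimal_plan3 \<mu> \<nu> \<gamma> L"
    "\<And>P. {p. P p} \<in> sets borel \<Longrightarrow> AE p in L. P p \<Longrightarrow> (AE p in L1. P p) \<and> (AE p in L2. P p)"
proof -
  have L12: "L1 \<in> couplings3 \<mu> \<nu> \<gamma>" "L2 \<in> couplings3 \<mu> \<nu> \<gamma>"
    using opt by (auto simp: optimal_plan3_def)
  interpret L1: prob_space L1 using couplings3D(1)[OF L12(1)] .
  interpret L2: prob_space L2 using couplings3D(1)[OF L12(2)] .
  let ?B = "measure_pmf (bernoulli_pmf (1/2))"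
  define k where "k b = (if b then L1 else L2)" for b
  define L where "L = ?B \<bind> k"
  have k: "k \<in> ?B \<rightarrow>\<^sub>M subprob_algebra borel"
    using couplings3D(2)[OF L12(1)] couplings3D(2)[OF L12(2)] 
    by (auto simp: k_def space_subprob_algebra L1.subprob_space_axioms L2.subprob_space_axioms)
  have sL: "sets L = sets borel"
    unfolding L_def
    by (rule sets_bind) (auto simp: k_def couplings3D(2)[OF L12(1)] couplings3D(2)[OF L12(2)])
  have marg: "distr L borel \<pi> = \<rho>"
    if \<pi>: "\<pi> \<in> borel_measurable borel" and "distr L1 borel \<pi> = \<rho>" "distr L2 borel \<pi> = \<rho>"
    for \<pi> :: "'a \<times> 'a \<times> 'a \<Rightarrow> 'a" and \<rho>
  proof -
    have "prob_space \<rho>"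
      using that couplings3D(2)[OF L12(1)] L1.prob_space_distr[of \<pi> borel]
      by (simp add: measurable_cong_sets[OF couplings3D(2)[OF L12(1)] refl])
    have "distr L borel \<pi> = ?B \<bind> (\<lambda>b. distr (k b) borel \<pi>)"
      unfolding L_def by (rule distr_bind[OF k]) (use \<pi> in auto)
    also have "(\<lambda>b. distr (k b) borel \<pi>) = (\<lambda>b. \<rho>)"
      using that by (auto simp: k_def)
    also have "?B \<bind> (\<lambda>b. \<rho>) = \<rho>"
      using \<open>prob_space \<rho>\<close> by (intro bind_const' prob_space_imp_subprob_space measure_pmf.prob_space_axioms)
    finally show ?thesis .
  qed
  have L: "L \<in> couplings3 \<mu> \<nu> \<gamma>"
    unfolding couplings3_def
  proof (intro CollectI conjI sL)
    show 1: "distr L borel fst = \<mu>"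
      by (rule marg[OF _ couplings3D(4)[OF L12(1)] couplings3D(4)[OF L12(2)]])
        (intro borel_measurable_continuous_onI continuous_intros)
    show "distr L borel (\<lambda>p. fst (snd p)) = \<nu>"
      by (rule marg[OF _ couplings3D(5)[OF L12(1)] couplings3D(5)[OF L12(2)]])
        (intro borel_measurable_continuous_onI continuous_intros)
    show "distr L borel (\<lambda>p. snd (snd p)) = \<gamma>"
      by (rule marg[OF _ couplings3D(6)[OF L12(1)] couplings3D(6)[OF L12(2)]])
        (intro borel_measurable_continuous_onI continuous_intros)
    have fst: "fst \<in> borel_measurable L" if "sets L = sets borel" for L :: "('a \<times> 'a \<times> 'a) measure"
      unfolding measurable_cong_sets[OF that refl] by (intro borel_measurable_continuous_onI continuous_intros)
    have "prob_space \<mu>"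
      using L1.prob_space_distr[OF fst] couplings3D(2,4)[OF L12(1)] by simp
    then show "prob_space L"
      using prob_space_distrD[OF fst[OF sL]] 1 by simp
  qed
  have nonneg: "0 \<le> cost3 p" for p :: "'a \<times> 'a \<times> 'a"
    by (auto simp: cost3_def split: prod.split)
  \<comment> \<open>The integral over a \<open>bind\<close> is computed with nonnegative extended
    integrals, so the cost is carried over and back.\<close>
  have nn: "(\<integral>\<^sup>+p. ennreal (cost3 p) \<partial>Q) = ennreal (integral\<^sup>L Q cost3)" if "Q \<in> couplings3 \<mu> \<nu> \<gamma>" for Q
    using couplings3_integrable_cost[OF that cpt] nonneg by (intro nn_integral_eq_integral) auto
  have "ennreal (integral\<^sup>L L cost3) = (\<integral>\<^sup>+p. ennreal (cost3 p) \<partial>L)"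
    by (rule nn[OF L, symmetric])
  also have "\<dots> = (\<integral>\<^sup>+b. (\<integral>\<^sup>+p. ennreal (cost3 p) \<partial>k b) \<partial>?B)"
    unfolding L_def by (rule nn_integral_bind[OF _ k]) simp
  also have "\<dots> = ennreal (integral\<^sup>L L1 cost3) * ennreal (1/2) + ennreal (integral\<^sup>L L2 cost3) * ennreal (1/2)"
    by (simp add: k_def nn[OF L12(1)] nn[OF L12(2)])
  also have "\<dots> = ennreal (integral\<^sup>L L1 cost3 * (1/2) + integral\<^sup>L L2 cost3 * (1/2))"
  proof -
    have "(0::real) \<le> 1/2" "0 \<le> integral\<^sup>L L1 cost3" "0 \<le> integral\<^sup>L L2 cost3"
      by (auto intro!: integral_nonneg_AE simp: nonneg)
    then show ?thesis
      by (simp only: ennreal_plus ennreal_mult mult_nonneg_nonneg)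
  qed
  finally have "integral\<^sup>L L cost3 = integral\<^sup>L L1 cost3 * (1/2) + integral\<^sup>L L2 cost3 * (1/2)"
    by (subst (asm) ennreal_inj) (auto intro!: integral_nonneg_AE add_nonneg_nonneg nonneg)
  moreover have "integral\<^sup>L L1 cost3 = integral\<^sup>L L2 cost3"
    using opt L12 by (meson optimal_plan3_def antisym)
  ultimately have "integral\<^sup>L L cost3 = integral\<^sup>L L1 cost3"
    by simp
  then have "optimal_plan3 \<mu> \<nu> \<gamma> L"
    using opt(1) L by (auto simp: optimal_plan3_def)
  moreover have "(AE p in L1. P p) \<and> (AE p in L2. P p)"
    if P: "{p. P p} \<in> sets borel" and "AE p in L. P p" for P
  proof -
    have "AE b in ?B. AE p in k b. P p"
      using that(2) P unfolding L_def by (subst (asm) AE_bind[OF k]) (auto simp: pred_def)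
    then have "\<forall>b. AE p in k b. P p"
      by (simp add: AE_measure_pmf_iff set_pmf_bernoulli)
    moreover have "k True = L1" "k False = L2"
      by (simp_all add: k_def)
    ultimately show ?thesis
      by metis
  qed
  ultimately show ?thesis
    using that by blast
qed

text \<open>Almost every \<open>p\<close> equals \<open>(fst p, T (fst p))\<close>, so
  \<open>L\<close> is recovered from its first marginal.\<close>

lemma couplings3_eq_distr_graph:
  assumes L: "L \<in> couplings3 \<mu> \<nu> \<gamma>" and T[measurable]: "T \<in> borel_measurable borel"
    and graph: "AE p in L. snd p = T (fst p)"
  shows "L = distr \<mu> borel (\<lambda>x. (x, T x))"
proof -
  note sL = couplings3D(2)[OF L]
  have fst: "fst \<in> borel_measurable L"
    unfolding measurable_cong_sets[OF sL refl] by (intro borel_measurable_continuous_onI continuous_intros)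
  have g: "(\<lambda>x. (x, T x)) \<in> borel_measurable borel"
    by (intro borel_measurable_Pair) auto
  have "distr \<mu> borel (\<lambda>x. (x, T x)) = distr L borel ((\<lambda>x. (x, T x)) \<circ> fst)"
    unfolding couplings3D(4)[OF L, symmetric] by (rule distr_distr[OF g fst])
  also have "\<dots> = distr L borel (\<lambda>p. p)"
  proof (rule distr_cong_AE)
    show "AE p in L. ((\<lambda>x. (x, T x)) \<circ> fst) p = p"
      using graph by eventually_elim (simp add: prod_eq_iff)
    show "(\<lambda>x. (x, T x)) \<circ> fst \<in> borel_measurable L"
      using fst g by (rule measurable_comp)
    show "(\<lambda>p. p) \<in> borel_measurable L"
      by (simp add: measurable_cong_sets[OF sL refl])
  qed simp_all
  also have "\<dots> = L"
    using distr_cong_sets[OF sL, of L "\<lambda>p. p"] distr_id[of L] by (simp add: id_def)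
  finally show ?thesis by simp
qed

lemma optimal_plan3_graph_map:
  assumes opt: "optimal_plan3 \<mu> \<nu> \<gamma> L"
    and prob: "prob_space \<nu>" "prob_space \<gamma>" and sets: "sets \<nu> = sets borel" "sets \<gamma> = sets borel"
    and cpt: "compact (measure_support \<mu>)" "compact (measure_support \<nu>)" "compact (measure_support \<gamma>)"
    and disj: "measure_support \<mu> \<inter> measure_support \<nu> = {}"
    and ac: "absolutely_continuous lborel \<mu>" "absolutely_continuous lborel \<gamma>"
  obtains T where "T \<in> borel_measurable borel" "range T \<subseteq> measure_support \<nu> \<times> measure_support \<gamma>"
    "AE p in L. snd p = T (fst p)"
proof -
  have L: "L \<in> couplings3 \<mu> \<nu> \<gamma>"
    using opt by (auto simp: optimal_plan3_def)
  obtain S where S: "S \<in> sets borel" "S \<subseteq> measure_support L" "AE p in L. p \<in> S" "inj_on fst S"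
    using optimal_plan3_concentrated_on_graph[OF opt cpt disj ac] .
  \<comment> \<open>Supports of probability measures are nonempty; this point serves as the default
    value that keeps the range of \<open>T\<close> in the product of supports.\<close>
  obtain y z where yz: "y \<in> measure_support \<nu>" "z \<in> measure_support \<gamma>"
    using eventually_happens'[OF prob_space.ae_filter_bot[OF prob(1)] AE_in_measure_support[OF sets(1)]]
      eventually_happens'[OF prob_space.ae_filter_bot[OF prob(2)] AE_in_measure_support[OF sets(2)]]
    by blast
  obtain T where T: "T \<in> borel_measurable borel" "AE p in L. snd p = T (fst p)"
    "\<And>x. (x, T x) \<in> S \<or> T x = (y, z)"
    using measurable_selection_of_graph[OF couplings3D(1,2)[OF L] S(1,3,4)] by metis
  have "T x \<in> measure_support \<nu> \<times> measure_support \<gamma>" for x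
    using T(3)[of x] S(2) couplings3_support_subset[OF L] yz by auto
  with T that show ?thesis by blast
qed

theorem mainTheorem10:
  fixes \<mu> \<nu> \<gamma> :: "'a::euclidean_space measure"
    and X Y Z :: "'a set"
  assumes "prob_space \<mu>" "prob_space \<nu>" "prob_space \<gamma>"
    and "sets \<mu> = sets borel" "sets \<nu> = sets borel" "sets \<gamma> = sets borel"
    and "X = measure_support \<mu>" "Y = measure_support \<nu>" "Z = measure_support \<gamma>"
    and "compact X" "compact Y" "compact Z"
    and "X \<inter> Y = {}"
    and "absolutely_continuous lborel \<mu>" "absolutely_continuous lborel \<gamma>"
  shows "(\<exists>!L. optimal_plan3 \<mu> \<nu> \<gamma> L) \<and>
    (\<forall>L. optimal_plan3 \<mu> \<nu> \<gamma> L \<longrightarrow>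
      (\<exists>T :: 'a \<Rightarrow> 'a \<times> 'a. T \<in> borel_measurable borel \<and> T ` X \<subseteq> Y \<times> Z \<and>
         L = distr \<mu> borel (\<lambda>x. (x, T x)) \<and>
         (\<forall>T' :: 'a \<Rightarrow> 'a \<times> 'a. T' \<in> borel_measurable borel \<and> T' ` X \<subseteq> Y \<times> Z \<and>
             L = distr \<mu> borel (\<lambda>x. (x, T' x)) \<longrightarrow> (AE x in \<mu>. T' x = T x))))"
proof -
  have cpt: "compact (measure_support \<mu>)" "compact (measure_support \<nu>)" "compact (measure_support \<gamma>)"
    and disj: "measure_support \<mu> \<inter> measure_support \<nu> = {}"
    using assms by auto
  note graph = optimal_plan3_graph_map[OF _ assms(2,3,5,6) cpt disj assms(14,15)]
  have coupling: "L \<in> couplings3 \<mu> \<nu> \<gamma>" if "optimal_plan3 \<mu> \<nu> \<gamma> L" for L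
    using that by (simp add: optimal_plan3_def)
  have unique: "L1 = L2" if opt: "optimal_plan3 \<mu> \<nu> \<gamma> L1" "optimal_plan3 \<mu> \<nu> \<gamma> L2" for L1 L2
  proof -
    obtain L where L: "optimal_plan3 \<mu> \<nu> \<gamma> L"
      "\<And>P. {p. P p} \<in> sets borel \<Longrightarrow> AE p in L. P p \<Longrightarrow> (AE p in L1. P p) \<and> (AE p in L2. P p)"
      using optimal_plan3_mixture[OF opt cpt] by blast
    obtain T where T: "T \<in> borel_measurable borel" "AE p in L. snd p = T (fst p)"
      using graph[OF L(1)] by metis
    have [measurable]: "T \<in> borel_measurable borel" by fact
    \<comment> \<open>The graph of \<open>T\<close> carries the average plan; being Borel, it then
      carries \<open>L1\<close> and \<open>L2\<close> as well, so both are the push-forward of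
      \<open>\<mu>\<close> under the same map.\<close>
    have "{p \<in> space (borel \<Otimes>\<^sub>M borel). snd p = T (fst p)} \<in> sets (borel \<Otimes>\<^sub>M borel)"
      by measurable
    then have "{p. snd p = T (fst p)} \<in> sets borel"
      by (simp only: borel_prod space_borel) simp
    from L(2)[OF this T(2)] show ?thesis
      using couplings3_eq_distr_graph[OF coupling[OF opt(1)] T(1)]
        couplings3_eq_distr_graph[OF coupling[OF opt(2)] T(1)] by simp
  qed
  show ?thesis
  proof (intro conjI allI impI)
    show "\<exists>!L. optimal_plan3 \<mu> \<nu> \<gamma> L"
      using optimal_plan3_exists[OF assms(1-6) cpt] unique by blast
  next
    fix L assume opt: "optimal_plan3 \<mu> \<nu> \<gamma> L"
    obtain T where T: "T \<in> borel_measurable borel" "range T \<subseteq> measure_support \<nu> \<times> measure_support \<gamma>"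
      "AE p in L. snd p = T (fst p)"
      using graph[OF opt] by metis
    have "AE x in \<mu>. T' x = T x"
      if T': "T' \<in> borel_measurable borel" "L = distr \<mu> borel (\<lambda>x. (x, T' x))" for T'
    proof -
      \<comment> \<open>Pulled back along \<open>x \<mapsto> (x, T' x)\<close>, the relation
        \<open>snd p = T (fst p)\<close> reads \<open>T' x = T x\<close>.\<close>
      have "(\<lambda>x. (x, T' x)) \<in> borel_measurable \<mu>"
        using T'(1) unfolding measurable_cong_sets[OF assms(4) refl] by (intro borel_measurable_Pair) auto
      from AE_distrD[OF this T(3)[unfolded T'(2)]] show ?thesis
        by simp
    qed
    then show "\<exists>T. T \<in> borel_measurable borel \<and> T ` X \<subseteq> Y \<times> Z \<and> L = distr \<mu> borel (\<lambda>x. (x, T x)) \<and>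
         (\<forall>T'. T' \<in> borel_measurable borel \<and> T' ` X \<subseteq> Y \<times> Z \<and>
             L = distr \<mu> borel (\<lambda>x. (x, T' x)) \<longrightarrow> (AE x in \<mu>. T' x = T x))"
      using T couplings3_eq_distr_graph[OF coupling[OF opt] T(1,3)] assms(8,9)
      by (intro exI[of _ T]) auto
  qed
qed

end
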